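(* Let $\Gamma=\Gamma(V,E)$ be a graph and let $\mathcal{M}=\{M_\alpha:\alpha\in V\}$ be a set of mutually disjoint monoids, each of which is left Fountain. Then the graph product $\mathscr{GP}(\Gamma,\mathcal{M})$ of $\mathcal{M}$ with respect to $\Gamma$ is a left Fountain monoid.
   Context: Graphs: $\Gamma=\Gamma(V,E)$ is a simple undirected graph without loops, with vertex set $V$ (possibly infinite), $|V|\ge 2$, and edge set $E$ a set of $2$-element subsets of $V$; write $(\alpha,\beta)\in E$ for $\{\alpha,\beta\}\in E$. Graph product: let $1_\alpha$ be the identity of $M_\alpha$ and $X=\bigcup_{\alpha\in V}M_\alpha$. Let $X^*$ be the free monoid on $X$, with juxtaposition written $\circ$ and empty word $\epsilon$. The graph product is the monoid $\mathscr{GP}(\Gamma,\mathcal{M})=X^*/R^\sharp$, where $R^\sharp$ is the congruence on $X^*$ generated by the relations: $1_\alpha=\epsilon$ ($\alpha\in V$); $x\circ y=xy$ ($x,y\in M_\alpha$, $\alpha\in V$, with $xy$ the product in $M_\alpha$); $x\circ y=y\circ x$ ($x\in M_\alpha$, $y\in M_\beta$, $(\alpha,\beta)\in E$). Left Fountain: on a monoid $M$ with set of idempotents $E(M)$, $a\,\widetilde{\mathcal{R}}\,b$ means that for all $e\in E(M)$, $ea=a$ if and only if $eb=b$. $M$ is left Fountain if every element of $M$ is $\widetilde{\mathcal{R}}$-related to an idempotent of $M$. (It is not assumed that $\widetilde{\mathcal{R}}$ is a left congruence.) *)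

theory Defs
  imports "HOL-Algebra.Group" "HOL-Library.Disjoint_Sets"
begin

section \<open>Simple graphs\<close>

definition simple_graph :: "'v set \<Rightarrow> 'v set set \<Rightarrow> bool" where
  "simple_graph V E \<longleftrightarrow> (\<forall>e\<in>E. e \<subseteq> V \<and> card e = 2)"

section \<open>Congruences and quotients of monoids\<close>

definition monoid_congruence :: "('a, 'm) monoid_scheme \<Rightarrow> ('a \<times> 'a) set \<Rightarrow> bool" where
  "monoid_congruence G r \<longleftrightarrow>
     equiv (carrier G) r \<and>
     (\<forall>a b c d. (a, b) \<in> r \<longrightarrow> (c, d) \<in> r \<longrightarrow> (a \<otimes>\<^bsub>G\<^esub> c, b \<otimes>\<^bsub>G\<^esub> d) \<in> r)"

definition generated_congruence ::
    "('a, 'm) monoid_scheme \<Rightarrow> ('a \<times> 'a) set \<Rightarrow> ('a \<times> 'a) set" where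
  "generated_congruence G R = \<Inter>{r. monoid_congruence G r \<and> R \<subseteq> r}"

text \<open>If \<open>r\<close> is a congruence, the double union below is the single class of
  \<open>a \<otimes> b\<close>, for any representatives \<open>a\<close> of \<open>A\<close> and \<open>b\<close> of \<open>B\<close>.\<close>

definition quotient_monoid ::
    "('a, 'm) monoid_scheme \<Rightarrow> ('a \<times> 'a) set \<Rightarrow> 'a set monoid" where
  "quotient_monoid G r =
     \<lparr>carrier = carrier G // r,
      monoid.mult = (\<lambda>A B. \<Union>a\<in>A. \<Union>b\<in>B. r `` {a \<otimes>\<^bsub>G\<^esub> b}),
      one = r `` {\<one>\<^bsub>G\<^esub>}\<rparr>"

section \<open>Graph products of monoids\<close>

definition free_monoid :: "'a set \<Rightarrow> 'a list monoid" where
  "free_monoid X = \<lparr>carrier = lists X, monoid.mult = (@), one = []\<rparr>"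

definition graph_product_relations ::
    "'v set \<Rightarrow> 'v set set \<Rightarrow> ('v \<Rightarrow> ('a, 'm) monoid_scheme) \<Rightarrow> ('a list \<times> 'a list) set" where
  "graph_product_relations V E M =
     {([\<one>\<^bsub>M \<alpha>\<^esub>], []) | \<alpha>. \<alpha> \<in> V} \<union>
     {([x, y], [x \<otimes>\<^bsub>M \<alpha>\<^esub> y]) | \<alpha> x y.
        \<alpha> \<in> V \<and> x \<in> carrier (M \<alpha>) \<and> y \<in> carrier (M \<alpha>)} \<union>
     {([x, y], [y, x]) | \<alpha> \<beta> x y.
        {\<alpha>, \<beta>} \<in> E \<and> x \<in> carrier (M \<alpha>) \<and> y \<in> carrier (M \<beta>)}"

definition graph_product ::
    "'v set \<Rightarrow> 'v set set \<Rightarrow> ('v \<Rightarrow> ('a, 'm) monoid_scheme) \<Rightarrow> 'a list set monoid" where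
  "graph_product V E M =
     (let F = free_monoid (\<Union>\<alpha>\<in>V. carrier (M \<alpha>))
      in quotient_monoid F (generated_congruence F (graph_product_relations V E M)))"

section \<open>Left Fountain monoids\<close>

definition idempotents :: "('a, 'm) monoid_scheme \<Rightarrow> 'a set" where
  "idempotents G = {e \<in> carrier G. e \<otimes>\<^bsub>G\<^esub> e = e}"

definition R_tilde :: "('a, 'm) monoid_scheme \<Rightarrow> ('a \<times> 'a) set" where
  "R_tilde G =
     {(a, b). a \<in> carrier G \<and> b \<in> carrier G \<and>
        (\<forall>e\<in>idempotents G. e \<otimes>\<^bsub>G\<^esub> a = a \<longleftrightarrow> e \<otimes>\<^bsub>G\<^esub> b = b)}"

definition left_fountain :: "('a, 'm) monoid_scheme \<Rightarrow> bool" where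
  "left_fountain G \<longleftrightarrow> (\<forall>a\<in>carrier G. \<exists>e\<in>idempotents G. (a, e) \<in> R_tilde G)"

end

(*
  Reduced words are unique up to shuffling letters of adjacent vertices, because letters act on
  shuffle classes of reduced words. If a reduced word f fixes a reduced word a, then, up to
  shuffling, f = q' H q and a = q' K r, where q and q' cancel letter by letter and the pairwise
  commuting letters of H fix those of K; if f is idempotent, so are the letters of H.

  It suffices to find, for each a, an idempotent e with e a = a that is fixed by every idempotent
  fixing a; this goes by induction on the length of a. If a = x b with y x = 1, every idempotent f
  fixing a satisfies f x = x g for some idempotent g, and x e' y works for a when e' works for b.
  If no letter that can be shuffled to the front of a is left invertible, then q' is empty, and the
  product of the idempotents belonging to all such letters works.
*)
theory Submission imports Defs begin

section \<open>Congruences and quotients\<close>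

text \<open>Such an \<open>e\<close> suffices because the converse is automatic: f e = e gives f a =
  f e a = e a = a. The obstacle is that R-tilde need not be a left congruence, so an idempotent for
  b need not yield one for x b. A left inverse y of x repairs this: f x = x g and f x b = x b give x
  g b = x b, hence g b = b after multiplying by y, hence g e' = e', and so f x e' y = x g e' y = x
  e' y. The case split is dictated by the shape of f: the first letter of q' is a front letter of a,
  and the last letter of q is a left inverse of it, so q' is empty when no front letter is left
  invertible. Then f is a product of commuting idempotent letters, each fixing a front letter of a,
  and the hypothesis on the vertex monoids applies letter by letter. The letters of H are idempotent
  because q f q' = H turns f f = f into H H = H, which can be projected onto single vertex
  monoids.\<close>

lemma monoid_congruence_generated:
  assumes "monoid G" "R \<subseteq> carrier G \<times> carrier G"
  shows "monoid_congruence G (generated_congruence G R)"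
proof -
  interpret monoid G by fact
  let ?S = "{r. monoid_congruence G r \<and> R \<subseteq> r}"
  \<comment> \<open>Membership of the full relation makes the intersection a relation on the
    carrier.\<close>
  have full: "carrier G \<times> carrier G \<in> ?S"
    using assms(2) by (auto simp: monoid_congruence_def equiv_def refl_on_def sym_def trans_def)
  have c: "equiv (carrier G) r"
    "(a, b) \<in> r \<Longrightarrow> (c, d) \<in> r \<Longrightarrow> (a \<otimes>\<^bsub>G\<^esub> c, b \<otimes>\<^bsub>G\<^esub> d) \<in> r" if "r \<in> ?S" for r a b c d
    using that by (auto simp: monoid_congruence_def)
  have "equiv (carrier G) (\<Inter>?S)"
  proof (rule equivI)
    show "\<Inter>?S \<subseteq> carrier G \<times> carrier G" using full by blast
    show "refl_on (carrier G) (\<Inter>?S)"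
      using c(1) by (auto simp: equiv_def refl_on_def)
    show "sym (\<Inter>?S)"
      by (rule symI) (use c(1) in \<open>auto simp: equiv_def dest: symD\<close>)
    show "trans (\<Inter>?S)"
      by (rule transI) (use c(1) in \<open>auto simp: equiv_def dest: transD\<close>)
  qed
  then show ?thesis
    unfolding monoid_congruence_def generated_congruence_def using c(2) by auto
qed

lemma generated_congruence_superset: "R \<subseteq> generated_congruence G R"
  by (auto simp: generated_congruence_def)

lemma generated_congruence_least:
  "monoid_congruence G r \<Longrightarrow> R \<subseteq> r \<Longrightarrow> generated_congruence G R \<subseteq> r"
  by (auto simp: generated_congruence_def)

lemma quotient_monoid_mult:
  assumes r: "monoid_congruence G r" and "a \<in> carrier G" "b \<in> carrier G"
  shows "r `` {a} \<otimes>\<^bsub>quotient_monoid G r\<^esub> r `` {b} = r `` {a \<otimes>\<^bsub>G\<^esub> b}"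
proof -
  have eq: "equiv (carrier G) r" and
    m: "\<And>a b c d. (a, b) \<in> r \<Longrightarrow> (c, d) \<in> r \<Longrightarrow> (a \<otimes>\<^bsub>G\<^esub> c, b \<otimes>\<^bsub>G\<^esub> d) \<in> r"
    using r unfolding monoid_congruence_def by blast+
  have "r `` {x \<otimes>\<^bsub>G\<^esub> y} = r `` {a \<otimes>\<^bsub>G\<^esub> b}" if "(a, x) \<in> r" "(b, y) \<in> r" for x y
    using equiv_class_eq[OF eq m[OF that]] by simp
  then have "(\<Union>x\<in>r `` {a}. \<Union>y\<in>r `` {b}. r `` {x \<otimes>\<^bsub>G\<^esub> y}) = (\<Union>x\<in>r `` {a}. \<Union>y\<in>r `` {b}. r `` {a \<otimes>\<^bsub>G\<^esub> b})"
    by (intro SUP_cong refl) simp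
  also have "\<dots> = r `` {a \<otimes>\<^bsub>G\<^esub> b}"
    using equiv_class_self[OF eq assms(2)] equiv_class_self[OF eq assms(3)] by blast
  finally show ?thesis by (simp add: quotient_monoid_def)
qed

lemma monoid_quotient_monoid:
  assumes "monoid G" and r: "monoid_congruence G r"
  shows "monoid (quotient_monoid G r)"
proof -
  interpret monoid G by fact
  let ?Q = "quotient_monoid G r"
  have c: "carrier ?Q = carrier G // r" and one: "\<one>\<^bsub>?Q\<^esub> = r `` {\<one>\<^bsub>G\<^esub>}"
    by (simp_all add: quotient_monoid_def)
  note mult = quotient_monoid_mult[OF r]
  show ?thesis
  proof (rule monoidI)
    fix x y assume "x \<in> carrier ?Q" "y \<in> carrier ?Q"
    then show "x \<otimes>\<^bsub>?Q\<^esub> y \<in> carrier ?Q"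
      unfolding c by (auto elim!: quotientE simp: mult intro!: quotientI)
  next
    show "\<one>\<^bsub>?Q\<^esub> \<in> carrier ?Q" unfolding c one by (intro quotientI) simp
  next
    fix x y z assume "x \<in> carrier ?Q" "y \<in> carrier ?Q" "z \<in> carrier ?Q"
    then show "x \<otimes>\<^bsub>?Q\<^esub> y \<otimes>\<^bsub>?Q\<^esub> z = x \<otimes>\<^bsub>?Q\<^esub> (y \<otimes>\<^bsub>?Q\<^esub> z)"
      unfolding c by (auto elim!: quotientE simp: mult m_assoc)
  next
    fix x assume "x \<in> carrier ?Q"
    then show "\<one>\<^bsub>?Q\<^esub> \<otimes>\<^bsub>?Q\<^esub> x = x" "x \<otimes>\<^bsub>?Q\<^esub> \<one>\<^bsub>?Q\<^esub> = x"
      unfolding c one by (auto elim!: quotientE simp: mult)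
  qed
qed

lemma monoid_free_monoid: "monoid (free_monoid X)"
  by (rule monoidI) (auto simp: free_monoid_def)

section \<open>Traces\<close>

locale commutation =
  fixes vert :: "'a \<Rightarrow> 'v" and adj :: "'v \<Rightarrow> 'v \<Rightarrow> bool"
  assumes adj_sym: "adj \<alpha> \<beta> \<Longrightarrow> adj \<beta> \<alpha>"
    and adj_irrefl: "\<not> adj \<alpha> \<alpha>"
begin

text \<open>Two words are trace equivalent iff one can be shuffled into the other by swapping
  letters of adjacent vertices; describing this by projections makes cancellation immediate.\<close>

definition trace_eq :: "'a list \<Rightarrow> 'a list \<Rightarrow> bool" (infix \<open>\<approx>\<close> 50) where
  "u \<approx> w \<longleftrightarrow> (\<forall>\<alpha> \<beta>. \<not> adj \<alpha> \<beta> \<longrightarrow>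
     filter (\<lambda>x. vert x = \<alpha> \<or> vert x = \<beta>) u = filter (\<lambda>x. vert x = \<alpha> \<or> vert x = \<beta>) w)"

abbreviation commutes :: "'a \<Rightarrow> 'a list \<Rightarrow> bool" where
  "commutes x w \<equiv> (\<forall>y\<in>set w. adj (vert x) (vert y))"

lemma trace_refl [simp]: "u \<approx> u"
  by (simp add: trace_eq_def)

lemma trace_sym: "u \<approx> w \<Longrightarrow> w \<approx> u"
  by (simp add: trace_eq_def)

lemma trace_trans [trans]: "u \<approx> w \<Longrightarrow> w \<approx> z \<Longrightarrow> u \<approx> z"
  by (simp add: trace_eq_def)

lemma trace_append: "u \<approx> u' \<Longrightarrow> w \<approx> w' \<Longrightarrow> u @ w \<approx> u' @ w'"
  by (simp add: trace_eq_def)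

lemma trace_Cons: "w \<approx> w' \<Longrightarrow> x # w \<approx> x # w'"
  by (simp add: trace_eq_def)

lemma trace_cancel_left: "u @ w \<approx> u @ w' \<Longrightarrow> w \<approx> w'"
  by (simp add: trace_eq_def)

lemma trace_cancel_right: "u @ w \<approx> u' @ w \<Longrightarrow> u \<approx> u'"
  by (simp add: trace_eq_def)

lemma trace_cancel_Cons: "x # w \<approx> x # w' \<Longrightarrow> w \<approx> w'"
  using trace_cancel_left[of "[x]"] by simp

lemma trace_set: assumes "u \<approx> w" shows "set u = set w"
proof -
  have "x \<in> set u \<longleftrightarrow> x \<in> set w" for x
  proof -
    have "filter (\<lambda>y. vert y = vert x \<or> vert y = vert x) u
        = filter (\<lambda>y. vert y = vert x \<or> vert y = vert x) w"
      using assms adj_irrefl unfolding trace_eq_def by blast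
    from arg_cong[OF this, of set] show ?thesis by auto
  qed
  then show ?thesis by blast
qed

lemma trace_move: assumes "commutes x u" shows "u @ x # z \<approx> x # u @ z"
proof -
  have "u @ [x] \<approx> [x] @ u"
    unfolding trace_eq_def
  proof (intro allI impI)
    fix \<alpha> \<beta> assume n: "\<not> adj \<alpha> \<beta>"
    let ?P = "\<lambda>x. vert x = \<alpha> \<or> vert x = \<beta>"
    \<comment> \<open>If the projection keeps \<open>x\<close>, one of the two vertices is that of
      \<open>x\<close> and the other is not adjacent to it, so no letter of \<open>u\<close>
      survives.\<close>
    have "filter ?P u = []" if "?P x"
      using that assms n adj_sym adj_irrefl by (auto simp: filter_empty_conv)
    then show "filter ?P (u @ [x]) = filter ?P ([x] @ u)" by auto
  qed
  from trace_append[OF this trace_refl[of z]] show ?thesis by simp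
qed

text \<open>Recovers actual shuffling from the projections. Cut \<open>w'\<close> at its first
  letter over the vertex of \<open>x\<close>; the projection onto that vertex shows that this letter
  is \<open>x\<close>. A letter of \<open>u\<close> not adjacent to \<open>x\<close> would make some
  projection of \<open>w'\<close> start inside \<open>u\<close>, while that of \<open>x # w\<close>
  starts with \<open>x\<close>.\<close>

lemma trace_ConsE:
  assumes "w' \<approx> x # w"
  obtains u z where "w' = u @ x # z" "commutes x u" "w \<approx> u @ z"
proof -
  have "x \<in> set w'" using trace_set[OF assms] by simp
  then have "\<exists>y\<in>set w'. vert y = vert x" by blast
  then obtain u x' z where w': "w' = u @ x' # z" and vx': "vert x' = vert x"
    and u: "\<forall>y\<in>set u. vert y \<noteq> vert x"
    using split_list_first_prop[of w' "\<lambda>y. vert y = vert x"] by metis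
  have P: "\<not> adj (vert x) \<beta> \<Longrightarrow> filter (\<lambda>y. vert y = vert x \<or> vert y = \<beta>) w'
      = filter (\<lambda>y. vert y = vert x \<or> vert y = \<beta>) (x # w)" for \<beta>
    using assms unfolding trace_eq_def by blast
  have "filter (\<lambda>y. vert y = vert x \<or> vert y = vert x) u = []"
    using u by (auto simp: filter_empty_conv)
  with P[of "vert x"] adj_irrefl have [simp]: "x' = x"
    using vx' by (simp add: w')
  have c: "commutes x u"
  proof (rule ballI, rule ccontr)
    fix y assume y: "y \<in> set u" and n: "\<not> adj (vert x) (vert y)"
    let ?P = "\<lambda>z. vert z = vert x \<or> vert z = vert y"
    from y have "filter ?P u \<noteq> []" by (auto simp: filter_empty_conv)
    then obtain b bs where b: "filter ?P u = b # bs" by (cases "filter ?P u") auto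
    then have "b \<in> set (filter ?P u)" by simp
    then have "b \<in> set u" by simp
    moreover have "b = x" using P[OF n] b by (simp add: w')
    ultimately show False using u by blast
  qed
  have "x # u @ z \<approx> w'" using trace_move[OF c] trace_sym w' by simp
  from trace_trans[OF this assms] have "w \<approx> u @ z"
    using trace_cancel_Cons trace_sym by blast
  then show thesis using that w' c by simp
qed

lemma trace_length: "u \<approx> w \<Longrightarrow> length u = length w"
proof (induction w arbitrary: u)
  case Nil then show ?case using trace_set by fastforce
next
  case (Cons x w)
  from Cons.prems obtain s z where "u = s @ x # z" "w \<approx> s @ z" by (rule trace_ConsE)
  with Cons.IH[of "s @ z"] show ?case using trace_sym by auto
qed

lemma trace_Nil [simp]: "w \<approx> [] \<longleftrightarrow> w = []" "[] \<approx> w \<longleftrightarrow> w = []"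
  using trace_length by fastforce+

lemma trace_Cons_Cons_same:
  assumes "x # w \<approx> y # z" "vert x = vert y"
  shows "x = y \<and> w \<approx> z"
proof -
  have "filter (\<lambda>y. vert y = vert x \<or> vert y = vert x) (x # w)
      = filter (\<lambda>y. vert y = vert x \<or> vert y = vert x) (y # z)"
    using assms adj_irrefl unfolding trace_eq_def by blast
  then have "x = y" using assms(2) by simp
  then show ?thesis using assms trace_cancel_Cons by blast
qed

lemma trace_snoc_snoc_same:
  assumes "w @ [x] \<approx> z @ [y]" "vert x = vert y"
  shows "x = y \<and> w \<approx> z"
proof -
  have "filter (\<lambda>y. vert y = vert x \<or> vert y = vert x) (w @ [x])
      = filter (\<lambda>y. vert y = vert x \<or> vert y = vert x) (z @ [y])"
    using assms adj_irrefl unfolding trace_eq_def by blast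
  then have "x = y" using assms(2) by simp
  then show ?thesis using assms trace_cancel_right by blast
qed

text \<open>The projection onto a single vertex determines the last letter of that vertex, so the
  two suffixes peel off from the right. This later extracts both h k = k and p = q' from the
  equation f a = a.\<close>

lemma trace_suffix_same_verts:
  assumes "map vert K = map vert H" "p @ K \<approx> q @ H"
  shows "K = H \<and> p \<approx> q"
  using assms
proof (induction H arbitrary: K rule: rev_induct)
  case Nil then show ?case by simp
next
  case (snoc h H)
  from snoc.prems(1) obtain K0 k where K: "K = K0 @ [k]"
    and v: "map vert K0 = map vert H" "vert k = vert h"
    by (auto simp: map_eq_append_conv)
  have "(p @ K0) @ [k] \<approx> (q @ H) @ [h]" using snoc.prems(2) K by simp
  from trace_snoc_snoc_same[OF this v(2)] snoc.IH[OF v(1)] show ?case by (simp add: K)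
qed

text \<open>Whether two letters may be swapped depends only on their vertices, so the same shuffle
  can be carried out on any word with the same vertex sequence.\<close>

lemma trace_transport:
  assumes "w \<approx> w1" "map vert w' = map vert w"
  shows "\<exists>w1'. w' \<approx> w1' \<and> map vert w1' = map vert w1"
  using assms
proof (induction w1 arbitrary: w w')
  case Nil then show ?case by auto
next
  case (Cons x w1)
  from Cons.prems(1) obtain u z where w: "w = u @ x # z" and c: "commutes x u" and t: "w1 \<approx> u @ z"
    by (rule trace_ConsE)
  from Cons.prems(2) obtain u' x' z' where w': "w' = u' @ x' # z'"
    and v: "map vert u' = map vert u" "vert x' = vert x" "map vert z' = map vert z"
    unfolding w by (auto simp: map_eq_append_conv map_eq_Cons_conv)
  obtain w1' where w1': "u' @ z' \<approx> w1'" "map vert w1' = map vert w1"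
    using Cons.IH[OF trace_sym[OF t], of "u' @ z'"] v by auto
  have "vert ` set u' = vert ` set u" using v(1) by (metis set_map)
  then have "commutes x' u'" using c v(2) by (metis (no_types, lifting) image_iff)
  then have "w' \<approx> x' # u' @ z'" unfolding w' by (rule trace_move)
  also have "\<dots> \<approx> x' # w1'" using w1'(1) by (rule trace_Cons)
  finally show ?case using w1'(2) v(2) by (intro exI[of _ "x' # w1'"]) simp
qed

lemma trace_append_ConsE:
  assumes "p @ s \<approx> x # w"
  obtains (left) p1 p2 where "p = p1 @ x # p2" "commutes x p1" "w \<approx> p1 @ p2 @ s"
  | (right) s1 s2 where "s = s1 @ x # s2" "commutes x p" "commutes x s1" "w \<approx> p @ s1 @ s2"
proof -
  from assms obtain u z where u: "p @ s = u @ x # z" "commutes x u" "w \<approx> u @ z"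
    by (rule trace_ConsE)
  from u(1) consider us where "p = u @ us" "us @ s = x # z" | us where "u = p @ us" "s = us @ x # z"
    by (auto simp: append_eq_append_conv2)
  then show thesis
  proof cases
    case 1
    \<comment> \<open>If \<open>us\<close> is empty, the occurrence of \<open>x\<close> is the first
      letter of \<open>s\<close>, which belongs to the second alternative.\<close>
    then show ?thesis using left[of u "tl us"] right[of "[]" z] u by (cases us) auto
  next
    case 2
    then show ?thesis using right[of us z] u by auto
  qed
qed

end

section \<open>Reduced words\<close>

locale graph_product_words =
  fixes V :: "'v set" and E :: "'v set set" and M :: "'v \<Rightarrow> ('a, 'm) monoid_scheme"
  assumes simple: "simple_graph V E"
    and monoids: "\<And>\<alpha>. \<alpha> \<in> V \<Longrightarrow> monoid (M \<alpha>)"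
    and disjoint: "disjoint_family_on (\<lambda>\<alpha>. carrier (M \<alpha>)) V"
begin

section \<open>Letters, their vertices, and products within one vertex monoid\<close>

definition letters :: "'a set" where
  "letters = (\<Union>\<alpha>\<in>V. carrier (M \<alpha>))"

definition vert :: "'a \<Rightarrow> 'v" where
  "vert x = (THE \<alpha>. \<alpha> \<in> V \<and> x \<in> carrier (M \<alpha>))"

text \<open>Meaningful only for letters of a common vertex; the left factor selects the
  monoid.\<close>

definition mul :: "'a \<Rightarrow> 'a \<Rightarrow> 'a" where
  "mul x y = x \<otimes>\<^bsub>M (vert x)\<^esub> y"

abbreviation unit :: "'v \<Rightarrow> 'a" where
  "unit \<alpha> \<equiv> \<one>\<^bsub>M \<alpha>\<^esub>"

abbreviation adj :: "'v \<Rightarrow> 'v \<Rightarrow> bool" where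
  "adj \<alpha> \<beta> \<equiv> {\<alpha>, \<beta>} \<in> E"

lemma adjD: "adj \<alpha> \<beta> \<Longrightarrow> \<alpha> \<in> V \<and> \<beta> \<in> V \<and> \<alpha> \<noteq> \<beta>"
  using simple unfolding simple_graph_def by fastforce

sublocale commutation vert adj
  by unfold_locales (use adjD insert_commute in metis)+

notation trace_eq (infix \<open>\<approx>\<close> 50)

lemma vert_eq: assumes "\<alpha> \<in> V" "x \<in> carrier (M \<alpha>)" shows "vert x = \<alpha>"
  unfolding vert_def
proof (rule the_equality)
  fix \<beta> assume "\<beta> \<in> V \<and> x \<in> carrier (M \<beta>)"
  then show "\<beta> = \<alpha>"
    using disjoint_family_onD[OF disjoint, of \<alpha> \<beta>] assms by auto
qed (use assms in simp)

lemma letterI: "\<alpha> \<in> V \<Longrightarrow> x \<in> carrier (M \<alpha>) \<Longrightarrow> x \<in> letters"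
  by (auto simp: letters_def)

lemma letterD: assumes "x \<in> letters" shows "vert x \<in> V" "x \<in> carrier (M (vert x))"
  using assms vert_eq by (auto simp: letters_def)

lemma letter_unit [simp]: assumes "\<alpha> \<in> V" shows "unit \<alpha> \<in> letters" "vert (unit \<alpha>) = \<alpha>"
  using assms letterI vert_eq monoid.one_closed[OF monoids] by blast+

lemma letter_mul [simp]:
  assumes "x \<in> letters" "y \<in> letters" "vert x = vert y"
  shows "mul x y \<in> letters" "vert (mul x y) = vert y"
proof -
  have "mul x y \<in> carrier (M (vert y))"
    using assms letterD[OF assms(1)] letterD[OF assms(2)] monoid.m_closed[OF monoids]
    by (simp add: mul_def)
  then show "mul x y \<in> letters" "vert (mul x y) = vert y"
    using letterI vert_eq letterD assms by blast+
qed

lemma mul_assoc: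
  assumes "x \<in> letters" "y \<in> letters" "z \<in> letters" "vert x = vert y" "vert y = vert z"
  shows "mul (mul x y) z = mul x (mul y z)"
  using assms letterD[OF assms(1)] letterD[OF assms(2)] letterD[OF assms(3)]
    monoid.m_assoc[OF monoids, of "vert z" x y z] letter_mul(2)[OF assms(1,2,4)]
  unfolding mul_def by simp

lemma mul_unit [simp]:
  assumes "x \<in> letters"
  shows "mul (unit (vert x)) x = x" "mul x (unit (vert x)) = x"
  using letterD[OF assms] monoids[of "vert x"]
  by (simp_all add: mul_def monoid.l_one monoid.r_one)

text \<open>Quantifying over all shuffles of \<open>w\<close> makes the notion invariant under
  \<open>\<approx>\<close> by construction.\<close>

definition reduced :: "'a list \<Rightarrow> bool" where
  "reduced w \<longleftrightarrow> (\<forall>x\<in>set w. x \<noteq> unit (vert x)) \<and>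
     (\<forall>u x y z. w \<approx> u @ x # y # z \<longrightarrow> vert x \<noteq> vert y)"

text \<open>Exactly the situation in which a letter of vertex \<alpha>, multiplied from the left,
  has no letter of the word to merge with.\<close>

definition headless :: "'v \<Rightarrow> 'a list \<Rightarrow> bool" where
  "headless \<alpha> w \<longleftrightarrow> (\<forall>x z. w \<approx> x # z \<longrightarrow> vert x \<noteq> \<alpha>)"

lemma headless_trace: "headless \<alpha> w \<Longrightarrow> w \<approx> w' \<Longrightarrow> headless \<alpha> w'"
  unfolding headless_def using trace_trans by blast

lemma reduced_trace: "reduced w \<Longrightarrow> w \<approx> w' \<Longrightarrow> reduced w'"
  unfolding reduced_def using trace_trans trace_set by metis

lemma reduced_Nil [simp]: "reduced []"
  by (simp add: reduced_def)

lemma reducedD: "reduced w \<Longrightarrow> w \<approx> u @ x # y # z \<Longrightarrow> vert x \<noteq> vert y"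
  unfolding reduced_def by blast

lemma headlessD: "headless \<alpha> w \<Longrightarrow> w \<approx> x # z \<Longrightarrow> vert x \<noteq> \<alpha>"
  unfolding headless_def by blast

lemma reduced_appendD:
  assumes "reduced (u @ w)" shows "reduced u" "reduced w"
proof -
  have "vert x \<noteq> vert y" if "u \<approx> u' @ x # y # z" for u' x y z
    using trace_append[OF that trace_refl[of w]] reducedD[OF assms, of u' x y "z @ w"] by simp
  then show "reduced u" using assms unfolding reduced_def by auto
  have "vert x \<noteq> vert y" if "w \<approx> u' @ x # y # z" for u' x y z
    using trace_append[OF trace_refl[of u] that] reducedD[OF assms, of "u @ u'" x y z] by simp
  then show "reduced w" using assms unfolding reduced_def by auto
qed

lemma reduced_ConsD:
  assumes "reduced (x # w)"
  shows "x \<noteq> unit (vert x)" "reduced w" "headless (vert x) w"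
proof -
  show "x \<noteq> unit (vert x)" "reduced w"
    using assms reduced_appendD(2)[of "[x]" w] by (auto simp: reduced_def)
  have "x # w \<approx> [] @ x # y # z" if "w \<approx> y # z" for y z
    using trace_Cons[OF that] by simp
  then show "headless (vert x) w" using assms unfolding reduced_def headless_def by metis
qed

text \<open>Suppose a shuffle of \<open>x # w\<close> makes \<open>a\<close>, \<open>b\<close> of
  one vertex adjacent. If \<open>x\<close> is neither, they are adjacent in a shuffle of
  \<open>w\<close>. If \<open>x\<close> is \<open>a\<close>, then \<open>b\<close> can reach the
  front of \<open>w\<close>. And \<open>x\<close> cannot be \<open>b\<close>, for it would have to
  pass \<open>a\<close>, a letter of its own vertex.\<close>

lemma reduced_Cons:
  assumes "x \<noteq> unit (vert x)" "reduced w" "headless (vert x) w"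
  shows "reduced (x # w)"
  unfolding reduced_def
proof (intro conjI allI impI notI)
  show "\<forall>y\<in>set (x # w). y \<noteq> unit (vert y)" using assms by (auto simp: reduced_def)
next
  fix u a b z assume t: "x # w \<approx> u @ a # b # z" and v: "vert a = vert b"
  have no: "\<not> w \<approx> s @ a # b # t" for s t using assms(2) v unfolding reduced_def by blast
  from trace_sym[OF t] show False
  proof (cases rule: trace_append_ConsE)
    case (left p1 p2)
    then show ?thesis using no[of "p1 @ p2" z] by simp
  next
    case (right s1 s2)
    show ?thesis
    proof (cases s1)
      case Nil
      then have "x = a" "s2 = b # z" using right by auto
      then have "w \<approx> b # u @ z" "vert b = vert x"
        using right trace_trans[OF _ trace_move] v Nil by auto
      then show ?thesis using assms(3) by (auto simp: headless_def)
    next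
      case (Cons c s1')
      with right have "c = a" "adj (vert x) (vert a)" "b # z = s1' @ x # s2" by auto
      then show ?thesis using right no[of u] v adj_irrefl Cons by (cases s1') auto
    qed
  qed
qed

text \<open>Apart from the ban on identities, reducedness is a property of the vertex sequence,
  because shuffling is. Hence letters may be replaced by nonidentity products at the same
  vertex.\<close>

lemma reduced_same_verts:
  assumes "reduced w" "map vert w' = map vert w" "\<forall>x\<in>set w'. x \<noteq> unit (vert x)"
  shows "reduced w'"
  unfolding reduced_def
proof (intro conjI allI impI notI)
  fix u x y z assume "w' \<approx> u @ x # y # z" "vert x = vert y"
  from trace_transport[OF this(1) assms(2)[symmetric]] obtain w1 where
    "w \<approx> w1" "map vert w1 = map vert u @ vert x # vert y # map vert z" by auto
  moreover from this(2) obtain u' x' y' z' where "w1 = u' @ x' # y' # z'" "vert x' = vert x" "vert y' = vert y"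
    by (auto simp: map_eq_append_conv map_eq_Cons_conv)
  ultimately show False using reducedD[OF assms(1)] \<open>vert x = vert y\<close> by metis
qed (use assms in blast)

text \<open>The obstruction must sit at the junction: a letter that can reach the end of
  \<open>u\<close> meets one of the same vertex that can reach the front of
  \<open>w\<close>.\<close>

lemma not_reduced_appendE:
  assumes "reduced u" "reduced w" "\<not> reduced (u @ w)"
  obtains x y u' w' where "u \<approx> u' @ [x]" "w \<approx> y # w'" "vert x = vert y"
proof -
  have "\<exists>x y u' w'. u \<approx> u' @ [x] \<and> w \<approx> y # w' \<and> vert x = vert y"
    using assms
  proof (induction u)
    case Nil then show ?case by simp
  next
    case (Cons a u)
    show ?case
    proof (cases "reduced (u @ w)")
      case False
      then obtain x y u' w' where "u \<approx> u' @ [x]" "w \<approx> y # w'" "vert x = vert y"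
        using Cons reduced_ConsD by blast
      then show ?thesis using trace_Cons[of u "u' @ [x]" a]
        by (intro exI[of _ x] exI[of _ y] exI[of _ "a # u'"] exI[of _ w']) auto
    next
      case True
      with Cons.prems reduced_Cons[of a "u @ w"] reduced_ConsD[OF Cons.prems(1)]
      have "\<not> headless (vert a) (u @ w)" by auto
      then obtain b z where b: "u @ w \<approx> b # z" "vert b = vert a"
        by (auto simp: headless_def)
      from b(1) show ?thesis
      proof (cases rule: trace_append_ConsE)
        case (left p1 p2)
        then have "u \<approx> b # p1 @ p2" using trace_move by simp
        then show ?thesis using reduced_ConsD(3)[OF Cons.prems(1)] b(2) by (auto simp: headless_def)
      next
        case (right s1 s2)
        \<comment> \<open>The letter \<open>b\<close> passed through all of \<open>u\<close>; since
          \<open>a\<close> has the same vertex, it passes through \<open>u\<close> in the other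
          direction.\<close>
        have "a # u \<approx> u @ [a]" using right(2) b(2) trace_move[of u a "[]"] trace_sym by auto
        moreover have "w \<approx> b # s1 @ s2" using right trace_move by simp
        ultimately show ?thesis using b(2) by metis
      qed
    qed
  qed
  then show thesis using that by blast
qed

section \<open>The action on reduced words\<close>

definition push :: "'a \<Rightarrow> 'a list \<Rightarrow> 'a list" where
  "push x w = (if x = unit (vert x) then w else x # w)"

lemma push_trace: "w \<approx> w' \<Longrightarrow> push x w \<approx> push x w'"
  by (simp add: push_def trace_Cons)

lemma set_push: "set (push x w) \<subseteq> insert x (set w)"
  by (auto simp: push_def)

lemma push_commute: "adj (vert x) (vert y) \<Longrightarrow> push x (push y w) \<approx> push y (push x w)"
  using trace_move[of "[x]" y w] adj_sym by (auto simp: push_def)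

lemma reduced_push: "reduced w \<Longrightarrow> headless (vert x) w \<Longrightarrow> reduced (push x w)"
  using reduced_Cons by (simp add: push_def)

lemma headless_push_adj:
  assumes "adj \<alpha> (vert x)" shows "headless \<alpha> (push x w) \<longleftrightarrow> headless \<alpha> w"
proof -
  have "headless \<alpha> (x # w) \<longleftrightarrow> headless \<alpha> w"
  proof
    assume h: "headless \<alpha> (x # w)"
    show "headless \<alpha> w"
      unfolding headless_def
    proof (intro allI impI notI)
      fix y z assume "w \<approx> y # z" "vert y = \<alpha>"
      then have "x # w \<approx> x # y # z" "adj (vert y) (vert x)"
        using assms trace_Cons by auto
      then have "x # w \<approx> y # x # z" using trace_trans trace_move[of "[x]" y z] by auto
      then show False using headlessD[OF h] \<open>vert y = \<alpha>\<close> by blast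
    qed
  next
    assume h: "headless \<alpha> w"
    show "headless \<alpha> (x # w)"
      unfolding headless_def
    proof (intro allI impI notI)
      fix y z assume t: "x # w \<approx> y # z" and v: "vert y = \<alpha>"
      have "[x] @ w \<approx> y # z" using t by simp
      then show False
      proof (cases rule: trace_append_ConsE)
        case (left p1 p2)
        then show ?thesis using assms v adj_irrefl by (cases p1) auto
      next
        case (right s1 s2)
        then have "w \<approx> y # s1 @ s2" using trace_move by simp
        then show ?thesis using headlessD[OF h] v by blast
      qed
    qed
  qed
  then show ?thesis by (simp add: push_def)
qed

section \<open>Splitting off the front component of one vertex\<close>

lemma push_unique:
  assumes "push x w \<approx> push y z" "vert x = vert y" "headless (vert x) w" "headless (vert x) z"
  shows "x = y \<and> w \<approx> z"
proof (cases "x = unit (vert x)")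
  case True
  then have "y = unit (vert y)"
    using assms headlessD[of "vert x" w y z] by (auto simp: push_def split: if_splits)
  then show ?thesis using True assms by (simp add: push_def)
next
  case False
  then have "y \<noteq> unit (vert y)"
    using assms headlessD[of "vert x" z x w] trace_sym by (auto simp: push_def split: if_splits)
  then show ?thesis using False assms trace_Cons_Cons_same[of x w y z] by (simp add: push_def)
qed

text \<open>The component \<open>y\<close> may be the identity, so every normal word splits at every
  vertex and one formula covers both the presence and the absence of a front letter. By
  \<open>push_unique\<close>, the splitting is unique up to shuffling \<open>z\<close>.\<close>

definition splits :: "'v \<Rightarrow> 'a list \<Rightarrow> 'a \<Rightarrow> 'a list \<Rightarrow> bool" where
  "splits \<alpha> w y z \<longleftrightarrow> w \<approx> push y z \<and> y \<in> letters \<and> vert y = \<alpha> \<and> headless \<alpha> z \<and>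
     reduced z \<and> set z \<subseteq> letters"

lemma ex_splits:
  assumes "reduced w" "set w \<subseteq> letters" "\<alpha> \<in> V"
  shows "\<exists>y z. splits \<alpha> w y z"
proof (cases "headless \<alpha> w")
  case True
  have "push (unit \<alpha>) w = w" using assms(3) by (simp add: push_def)
  then have "splits \<alpha> w (unit \<alpha>) w" using True assms by (simp add: splits_def)
  then show ?thesis by blast
next
  case False
  then obtain y z where y: "w \<approx> y # z" "vert y = \<alpha>" by (auto simp: headless_def)
  have r: "reduced (y # z)" using reduced_trace assms(1) y(1) by blast
  have "set (y # z) \<subseteq> letters" using trace_set[OF y(1)] assms(2) by blast
  moreover have "push y z = y # z" using reduced_ConsD(1)[OF r] by (simp add: push_def)
  ultimately have "splits \<alpha> w y z"
    using y reduced_ConsD(2,3)[OF r] by (auto simp: splits_def)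
  then show ?thesis by blast
qed

text \<open>Multiplies \<open>x\<close> into the front component of its vertex. Different splittings
  change the result only by a shuffle, so the choice is harmless up to
  \<open>\<approx>\<close>.\<close>

definition act :: "'a \<Rightarrow> 'a list \<Rightarrow> 'a list" where
  "act x w = (SOME u. \<exists>y z. splits (vert x) w y z \<and> u = push (mul x y) z)"

lemma act_eq:
  assumes "splits (vert x) w y z" "x \<in> letters"
  shows "act x w \<approx> push (mul x y) z"
proof -
  have "\<exists>y z. splits (vert x) w y z \<and> act x w = push (mul x y) z"
    unfolding act_def using someI_ex[of "\<lambda>u. \<exists>y z. splits (vert x) w y z \<and> u = push (mul x y) z"] assms(1)
    by blast
  then obtain y' z' where s: "splits (vert x) w y' z'" and a: "act x w = push (mul x y') z'"
    by blast
  have "push y' z' \<approx> push y z" using s assms(1) trace_sym trace_trans unfolding splits_def by blast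
  then have "y' = y \<and> z' \<approx> z"
    by (rule push_unique) (use s assms(1) in \<open>auto simp: splits_def\<close>)
  then show ?thesis using a push_trace by simp
qed

definition normal :: "'a list set" where
  "normal = {w. reduced w \<and> set w \<subseteq> letters}"

lemma normal_trace: "w \<in> normal \<Longrightarrow> w \<approx> w' \<Longrightarrow> w' \<in> normal"
  using reduced_trace trace_set by (fastforce simp: normal_def)

text \<open>The remainder \<open>z\<close> survives, so successive letters of one vertex multiply
  into the same component; \<open>act_act\<close> thereby reduces to associativity.\<close>

lemma splits_act:
  assumes "splits (vert x) w y z" "x \<in> letters"
  shows "splits (vert x) (act x w) (mul x y) z"
  using act_eq[OF assms] assms by (simp add: splits_def)

lemma splits_normal: "splits \<alpha> w y z \<Longrightarrow> w \<in> normal"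
  using normal_trace[of "push y z" w] reduced_push[of z y] set_push[of y z] trace_sym
  by (force simp: splits_def normal_def)

lemma act_normal: "w \<in> normal \<Longrightarrow> x \<in> letters \<Longrightarrow> act x w \<in> normal"
  using ex_splits[of w "vert x"] splits_act splits_normal letterD(1) unfolding normal_def by blast

lemma splits_trace: "splits \<alpha> w y z \<Longrightarrow> w \<approx> w' \<Longrightarrow> splits \<alpha> w' y z"
  unfolding splits_def using trace_sym trace_trans by blast

lemma act_trace:
  assumes "w \<in> normal" "w \<approx> w'" "x \<in> letters"
  shows "act x w \<approx> act x w'"
proof -
  obtain y z where "splits (vert x) w y z"
    using ex_splits[of w "vert x"] assms letterD by (auto simp: normal_def)
  then show ?thesis using act_eq splits_trace assms trace_sym trace_trans by metis
qed

lemma act_unit: assumes "w \<in> normal" "\<alpha> \<in> V" shows "act (unit \<alpha>) w \<approx> w"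
proof -
  obtain y z where s: "splits \<alpha> w y z"
    using ex_splits[of w \<alpha>] assms by (auto simp: normal_def)
  then have "mul (unit \<alpha>) y = y" "w \<approx> push y z"
    using mul_unit(1)[of y] by (auto simp: splits_def)
  moreover have "act (unit \<alpha>) w \<approx> push (mul (unit \<alpha>) y) z"
    using act_eq[of "unit \<alpha>" w y z] s assms(2) by simp
  ultimately show ?thesis using trace_sym trace_trans by metis
qed

lemma act_act:
  assumes "w \<in> normal" "x \<in> letters" "y \<in> letters" "vert x = vert y"
  shows "act x (act y w) \<approx> act (mul x y) w"
proof -
  obtain h z where s: "splits (vert y) w h z"
    using ex_splits[of w "vert y"] assms letterD by (auto simp: normal_def)
  have "act x (act y w) \<approx> push (mul x (mul y h)) z"
    using act_eq[of x "act y w" "mul y h" z] splits_act[OF s assms(3)] assms by simp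
  moreover have "act (mul x y) w \<approx> push (mul (mul x y) h) z"
    using act_eq[of "mul x y" w h z] s assms by simp
  moreover have "mul (mul x y) h = mul x (mul y h)"
    using mul_assoc assms s by (simp add: splits_def)
  ultimately show ?thesis using trace_sym trace_trans by metis
qed

text \<open>Splitting off the component \<open>h\<close> at the first vertex and then
  \<open>k\<close> at the second leaves a rest \<open>t\<close> headless at both. Each letter
  changes only its own component, and pushes at adjacent vertices commute, so the order of acting
  does not matter.\<close>

lemma act_commute:
  assumes "w \<in> normal" "x \<in> letters" "y \<in> letters" "adj (vert x) (vert y)"
  shows "act x (act y w) \<approx> act y (act x w)"
proof -
  have yx: "adj (vert y) (vert x)" using assms(4) adj_sym by blast
  obtain h z where s: "splits (vert x) w h z"
    using ex_splits[of w "vert x"] assms letterD by (auto simp: normal_def)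
  obtain k t where s': "splits (vert y) z k t"
    using ex_splits[of z "vert y"] assms letterD s by (auto simp: splits_def)
  have vh: "h \<in> letters" "vert h = vert x" and vk: "k \<in> letters" "vert k = vert y"
    using s s' by (auto simp: splits_def)
  have tx: "headless (vert x) t"
    using headless_push_adj[of "vert x" k t] headless_trace[of "vert x" z "push k t"] s s' assms(4)
    by (auto simp: splits_def)
  have ty: "headless (vert y) t" and t: "t \<in> normal" using s' by (auto simp: splits_def normal_def)
  have two: "splits (vert x) (push b (push a t)) a (push b t) \<and> splits (vert y) (push a (push b t)) b (push a t)"
    if "a \<in> letters" "vert a = vert x" "b \<in> letters" "vert b = vert y" for a b
    using that push_commute[of b a t] push_commute[of a b t] assms(4) yx headless_push_adj
      reduced_push[of t a] reduced_push[of t b] tx ty t set_push[of a t] set_push[of b t]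
    unfolding splits_def normal_def by auto
  have w: "w \<approx> push h (push k t)" "w \<approx> push k (push h t)"
    using s s' push_trace trace_trans push_commute[of h k t] assms(4) vh vk unfolding splits_def
    by metis+
  let ?h = "mul x h" and ?k = "mul y k"
  have mh: "?h \<in> letters" "vert ?h = vert x" and mk: "?k \<in> letters" "vert ?k = vert y"
    using vh vk assms by simp_all
  have "act x w \<approx> push ?h (push k t)"
    using act_eq[of x w h "push k t"] two[of h k] splits_trace[OF _ trace_sym[OF w(2)]] vh vk assms by blast
  then have "splits (vert y) (act x w) k (push ?h t)"
    using two[of ?h k] splits_trace trace_sym mh vk by blast
  then have 1: "act y (act x w) \<approx> push ?k (push ?h t)" using act_eq assms by blast
  have "act y w \<approx> push ?k (push h t)"
    using act_eq[of y w k "push h t"] two[of h k] splits_trace[OF _ trace_sym[OF w(1)]] vh vk assms by blast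
  then have "splits (vert x) (act y w) h (push ?k t)"
    using two[of h ?k] splits_trace trace_sym vh mk by blast
  then have 2: "act x (act y w) \<approx> push ?h (push ?k t)" using act_eq assms by blast
  have "push ?h (push ?k t) \<approx> push ?k (push ?h t)"
    using push_commute mh mk assms(4) by simp
  then show ?thesis using 1 2 trace_sym trace_trans by metis
qed

section \<open>The graph product congruence on words\<close>

definition word_cong :: "'a list \<Rightarrow> 'a list \<Rightarrow> bool" (infix \<open>\<doteq>\<close> 50) where
  "u \<doteq> w \<longleftrightarrow> (u, w) \<in> generated_congruence (free_monoid letters) (graph_product_relations V E M)"

lemma relations_words:
  "graph_product_relations V E M \<subseteq> lists letters \<times> lists letters"
proof -
  have "adj \<alpha> \<beta> \<Longrightarrow> x \<in> carrier (M \<alpha>) \<Longrightarrow> y \<in> carrier (M \<beta>) \<Longrightarrow> x \<in> letters \<and> y \<in> letters"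
    for \<alpha> \<beta> x y using adjD letterI by blast
  moreover have "\<alpha> \<in> V \<Longrightarrow> x \<in> carrier (M \<alpha>) \<Longrightarrow> y \<in> carrier (M \<alpha>) \<Longrightarrow> x \<otimes>\<^bsub>M \<alpha>\<^esub> y \<in> letters"
    for \<alpha> x y using letterI monoid.m_closed[OF monoids] by blast
  ultimately show ?thesis
    unfolding graph_product_relations_def using letterI by auto
qed

lemma congruence_generated:
  "monoid_congruence (free_monoid letters)
     (generated_congruence (free_monoid letters) (graph_product_relations V E M))"
  using monoid_congruence_generated[OF monoid_free_monoid] relations_words
  by (simp add: free_monoid_def)

lemma cong_equiv:
  "equiv (lists letters) (generated_congruence (free_monoid letters) (graph_product_relations V E M))"
  using congruence_generated by (simp add: monoid_congruence_def free_monoid_def)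

lemma cong_refl [simp]: "set w \<subseteq> letters \<Longrightarrow> w \<doteq> w"
  using cong_equiv by (auto simp: word_cong_def equiv_def refl_on_def)

lemma cong_sym: "u \<doteq> w \<Longrightarrow> w \<doteq> u"
  using cong_equiv by (auto simp: word_cong_def equiv_def dest: symD)

lemma cong_trans [trans]: "u \<doteq> w \<Longrightarrow> w \<doteq> z \<Longrightarrow> u \<doteq> z"
  using cong_equiv by (auto simp: word_cong_def equiv_def dest: transD)

lemma cong_letters: assumes "u \<doteq> w" shows "set u \<subseteq> letters" "set w \<subseteq> letters"
  using cong_equiv assms by (auto simp: word_cong_def equiv_def)

lemma cong_append: "u \<doteq> u' \<Longrightarrow> w \<doteq> w' \<Longrightarrow> u @ w \<doteq> u' @ w'"
  using congruence_generated by (auto simp: word_cong_def monoid_congruence_def free_monoid_def)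

lemma cong_context:
  "u \<doteq> w \<Longrightarrow> set p \<subseteq> letters \<Longrightarrow> set s \<subseteq> letters \<Longrightarrow> p @ u @ s \<doteq> p @ w @ s"
  by (intro cong_append cong_refl)

lemma cong_unit: "\<alpha> \<in> V \<Longrightarrow> [unit \<alpha>] \<doteq> []"
  unfolding word_cong_def
  by (rule subsetD[OF generated_congruence_superset]) (auto simp: graph_product_relations_def)

lemma cong_mul:
  assumes "x \<in> letters" "y \<in> letters" "vert x = vert y" shows "[x, y] \<doteq> [mul x y]"
proof -
  have "([x, y], [mul x y]) \<in> graph_product_relations V E M"
    unfolding graph_product_relations_def mul_def
    using letterD[OF assms(1)] letterD[OF assms(2)] assms(3) by auto
  then show ?thesis unfolding word_cong_def using generated_congruence_superset by blast
qed

lemma cong_swap: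
  assumes "x \<in> letters" "y \<in> letters" "adj (vert x) (vert y)" shows "[x, y] \<doteq> [y, x]"
proof -
  have "([x, y], [y, x]) \<in> graph_product_relations V E M"
    unfolding graph_product_relations_def using letterD assms by blast
  then show ?thesis unfolding word_cong_def using generated_congruence_superset by blast
qed

lemma cong_move:
  assumes "commutes x u" "x \<in> letters" "set u \<subseteq> letters"
  shows "u @ [x] \<doteq> x # u"
  using assms
proof (induction u)
  case Nil then show ?case by simp
next
  case (Cons a u)
  have "[a] @ u @ [x] \<doteq> [a] @ x # u"
    using Cons by (intro cong_append cong_refl) auto
  also have "\<dots> \<doteq> x # a # u"
    using Cons.prems cong_append[OF cong_swap[of a x] cong_refl[of u]] adj_sym by simp
  finally show ?case by simp
qed

lemma cong_trace: "u \<approx> w \<Longrightarrow> set u \<subseteq> letters \<Longrightarrow> u \<doteq> w"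
proof (induction w arbitrary: u)
  case Nil then show ?case by simp
next
  case (Cons x w)
  from Cons.prems(1) obtain s z where u: "u = s @ x # z" "commutes x s" "w \<approx> s @ z"
    by (rule trace_ConsE)
  have "s @ z \<doteq> w" using Cons.IH[OF trace_sym[OF u(3)]] Cons.prems(2) u(1) by auto
  moreover have "s @ x # z \<doteq> x # s @ z"
    using cong_append[OF cong_move[OF u(2)] cong_refl[of z]] Cons.prems(2) u(1) by auto
  ultimately show ?case
    using u(1) cong_append[of "[x]" "[x]" "s @ z" w] Cons.prems(2) cong_trans by auto
qed

text \<open>The minimality of the congruence in terms of \<open>vert\<close> and \<open>mul\<close>.
  It is applied to two invariants: the action on normal words and the retractions onto the vertex
  monoids.\<close>

lemma word_cong_least:
  assumes "monoid_congruence (free_monoid letters) r"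
    and "\<And>\<alpha>. \<alpha> \<in> V \<Longrightarrow> ([unit \<alpha>], []) \<in> r"
    and "\<And>x y. x \<in> letters \<Longrightarrow> y \<in> letters \<Longrightarrow> vert x = vert y \<Longrightarrow> ([x, y], [mul x y]) \<in> r"
    and "\<And>x y. x \<in> letters \<Longrightarrow> y \<in> letters \<Longrightarrow> adj (vert x) (vert y) \<Longrightarrow> ([x, y], [y, x]) \<in> r"
    and "u \<doteq> w"
  shows "(u, w) \<in> r"
proof -
  have "graph_product_relations V E M \<subseteq> r"
  proof
    fix p assume "p \<in> graph_product_relations V E M"
    then consider \<alpha> where "p = ([unit \<alpha>], [])" "\<alpha> \<in> V"
      | \<alpha> x y where "p = ([x, y], [x \<otimes>\<^bsub>M \<alpha>\<^esub> y])" "\<alpha> \<in> V" "x \<in> carrier (M \<alpha>)" "y \<in> carrier (M \<alpha>)"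
      | \<alpha> \<beta> x y where "p = ([x, y], [y, x])" "adj \<alpha> \<beta>" "x \<in> carrier (M \<alpha>)" "y \<in> carrier (M \<beta>)"
      unfolding graph_product_relations_def by blast
    then show "p \<in> r"
    proof cases
      case 1 then show ?thesis using assms(2) by simp
    next
      case 2 then show ?thesis using assms(3)[of x y] letterI vert_eq by (auto simp: mul_def)
    next
      case 3 then show ?thesis using assms(4)[of x y] letterI vert_eq adjD[of \<alpha> \<beta>] by metis
    qed
  qed
  then show ?thesis
    using generated_congruence_least[OF assms(1)] assms(5) unfolding word_cong_def by blast
qed

section \<open>Uniqueness of reduced words\<close>

lemma foldr_act_normal: "set u \<subseteq> letters \<Longrightarrow> w \<in> normal \<Longrightarrow> foldr act u w \<in> normal"
  by (induction u) (auto simp: act_normal)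

lemma foldr_act_trace:
  "set u \<subseteq> letters \<Longrightarrow> w \<in> normal \<Longrightarrow> w \<approx> w' \<Longrightarrow> foldr act u w \<approx> foldr act u w'"
  by (induction u) (auto simp: act_trace foldr_act_normal)

lemma foldr_act_cong:
  assumes "u \<doteq> u'" "w \<in> normal"
  shows "foldr act u w \<approx> foldr act u' w"
proof -
  define r where "r = {(u, u'). set u \<subseteq> letters \<and> set u' \<subseteq> letters \<and>
    (\<forall>w\<in>normal. foldr act u w \<approx> foldr act u' w)}"
  have "monoid_congruence (free_monoid letters) r"
    unfolding monoid_congruence_def
  proof (intro conjI allI impI)
    show "equiv (carrier (free_monoid letters)) r"
    proof (rule equivI)
      show "r \<subseteq> carrier (free_monoid letters) \<times> carrier (free_monoid letters)"
        by (auto simp: r_def free_monoid_def)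
      show "refl_on (carrier (free_monoid letters)) r"
        by (auto simp: r_def free_monoid_def refl_on_def)
      show "sym r" unfolding sym_def r_def using trace_sym by blast
      show "trans r" unfolding trans_def r_def using trace_trans by blast
    qed
  next
    fix a b c d assume ab: "(a, b) \<in> r" and cd: "(c, d) \<in> r"
    have "foldr act a (foldr act c w) \<approx> foldr act b (foldr act d w)" if "w \<in> normal" for w
    proof -
      have "foldr act a (foldr act c w) \<approx> foldr act a (foldr act d w)"
        using ab cd that foldr_act_trace foldr_act_normal by (auto simp: r_def)
      also have "\<dots> \<approx> foldr act b (foldr act d w)"
        using ab cd that foldr_act_normal by (auto simp: r_def)
      finally show ?thesis .
    qed
    then show "(a \<otimes>\<^bsub>free_monoid letters\<^esub> c, b \<otimes>\<^bsub>free_monoid letters\<^esub> d) \<in> r"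
      using ab cd by (auto simp: r_def free_monoid_def)
  qed
  then have "(u, u') \<in> r"
    by (rule word_cong_least[OF _ _ _ _ assms(1)])
      (auto simp: r_def act_unit act_act act_commute)
  then show ?thesis using assms(2) by (auto simp: r_def)
qed

text \<open>Each new letter meets a word that is headless at its vertex, so its front component
  there is the identity and the letter is simply prefixed.\<close>

lemma foldr_act_reduced: "w \<in> normal \<Longrightarrow> foldr act w [] \<approx> w"
proof (induction w)
  case Nil then show ?case by simp
next
  case (Cons x w)
  then have x: "x \<in> letters" and w: "w \<in> normal" and rx: "reduced (x # w)"
    using reduced_ConsD by (auto simp: normal_def)
  have "splits (vert x) w (unit (vert x)) w"
    using w reduced_ConsD(3)[OF rx] letterD(1)[OF x] by (auto simp: splits_def push_def normal_def)
  then have "act x w \<approx> push (mul x (unit (vert x))) w" using act_eq x by blast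
  also have "\<dots> = x # w" using x reduced_ConsD(1)[OF rx] by (simp add: push_def)
  finally have "act x w \<approx> x # w" .
  moreover have "act x (foldr act w []) \<approx> act x w"
    using Cons.IH[OF w] w x act_trace normal_trace trace_sym by blast
  ultimately show ?case using trace_trans by auto
qed

lemma reduced_unique:
  assumes "u \<in> normal" "w \<in> normal" "u \<doteq> w" shows "u \<approx> w"
proof -
  have "u \<approx> foldr act u []" using foldr_act_reduced[OF assms(1)] by (rule trace_sym)
  also have "\<dots> \<approx> foldr act w []" by (rule foldr_act_cong[OF assms(3)]) (simp add: normal_def)
  also have "\<dots> \<approx> w" by (rule foldr_act_reduced[OF assms(2)])
  finally show ?thesis .
qed

text \<open>Every violation of reducedness permits a shorter congruent word: delete an identity, or
  shuffle two letters of one vertex together and multiply them.\<close>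

lemma ex_normal: "set w \<subseteq> letters \<Longrightarrow> \<exists>u\<in>normal. w \<doteq> u"
proof (induction w rule: length_induct)
  case (1 w)
  show ?case
  proof (cases "reduced w")
    case True
    then show ?thesis using 1 cong_refl by (auto simp: normal_def)
  next
    case False
    have "\<exists>w'. length w' < length w \<and> w \<doteq> w'"
    proof (cases "\<forall>x\<in>set w. x \<noteq> unit (vert x)")
      case True
      with False obtain u x y z where t: "w \<approx> u @ x # y # z" and v: "vert x = vert y"
        by (auto simp: reduced_def)
      have l: "set (u @ x # y # z) \<subseteq> letters" using trace_set[OF t] 1 by simp
      have "u @ [x, y] @ z \<doteq> u @ [mul x y] @ z"
        using l v by (intro cong_context cong_mul) auto
      then have "w \<doteq> u @ [mul x y] @ z" using cong_trace[OF t] 1 cong_trans by auto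
      then show ?thesis using trace_length[OF t] by (intro exI[of _ "u @ [mul x y] @ z"]) simp
    next
      case False
      then obtain x where x: "x \<in> set w" "x = unit (vert x)" by blast
      from split_list[OF x(1)] obtain u z where w: "w = u @ x # z" by blast
      have "[x] \<doteq> []" using cong_unit[of "vert x"] x w letterD 1 by auto
      from cong_context[OF this, of u z] have "w \<doteq> u @ z" using w 1 by simp
      then show ?thesis using w by (intro exI[of _ "u @ z"]) simp
    qed
    then obtain w' where w': "length w' < length w" "w \<doteq> w'" by blast
    then obtain u where "u \<in> normal" "w' \<doteq> u" using 1(1) cong_letters(2)[OF w'(2)] by blast
    then show ?thesis using cong_trans[OF w'(2)] by blast
  qed
qed

section \<open>Retractions onto the vertex monoids\<close>

text \<open>The homomorphism onto \<open>M \<alpha>\<close> that kills all other vertices, written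
  on words. It reads off single letters from congruences between words that are not reduced, where
  uniqueness of reduced words says nothing directly.\<close>

definition retract :: "'v \<Rightarrow> 'a list \<Rightarrow> 'a" where
  "retract \<alpha> w = foldr (\<lambda>x y. if vert x = \<alpha> then mul x y else y) w (unit \<alpha>)"

lemma retract_simps [simp]:
  "retract \<alpha> [] = unit \<alpha>"
  "retract \<alpha> (x # w) = (if vert x = \<alpha> then mul x (retract \<alpha> w) else retract \<alpha> w)"
  by (simp_all add: retract_def)

lemma retract_letter:
  assumes "\<alpha> \<in> V" "set w \<subseteq> letters"
  shows "retract \<alpha> w \<in> letters \<and> vert (retract \<alpha> w) = \<alpha>"
  using assms by (induction w) auto

lemma retract_append:
  assumes "\<alpha> \<in> V" "set u \<subseteq> letters" "set w \<subseteq> letters"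
  shows "retract \<alpha> (u @ w) = mul (retract \<alpha> u) (retract \<alpha> w)"
  using assms(2)
proof (induction u)
  case Nil
  then show ?case using mul_unit(1)[of "retract \<alpha> w"] retract_letter[OF assms(1,3)] by simp
next
  case (Cons x u)
  then show ?case
    using mul_assoc[of x "retract \<alpha> u" "retract \<alpha> w"] retract_letter[OF assms(1,3)]
      retract_letter[OF assms(1), of u] by simp
qed

lemma retract_cong:
  assumes "u \<doteq> w" "\<alpha> \<in> V" shows "retract \<alpha> u = retract \<alpha> w"
proof -
  define r where "r = {(u, w). set u \<subseteq> letters \<and> set w \<subseteq> letters \<and> retract \<alpha> u = retract \<alpha> w}"
  have "monoid_congruence (free_monoid letters) r"
    unfolding monoid_congruence_def
  proof (intro conjI allI impI)
    show "equiv (carrier (free_monoid letters)) r"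
      unfolding equiv_def refl_on_def sym_def trans_def r_def free_monoid_def by auto
  next
    fix a b c d assume "(a, b) \<in> r" "(c, d) \<in> r"
    then show "(a \<otimes>\<^bsub>free_monoid letters\<^esub> c, b \<otimes>\<^bsub>free_monoid letters\<^esub> d) \<in> r"
      by (simp add: r_def free_monoid_def retract_append[OF assms(2)])
  qed
  then have "(u, w) \<in> r"
  proof (rule word_cong_least[OF _ _ _ _ assms(1)])
    fix \<beta> assume "\<beta> \<in> V"
    then show "([unit \<beta>], []) \<in> r"
      using mul_unit(1)[of "unit \<beta>"] by (auto simp: r_def)
  next
    fix x y assume xy: "x \<in> letters" "y \<in> letters" "vert x = vert y"
    then have "mul x (mul y (unit (vert y))) = mul (mul x y) (unit (vert y))"
      using letterD by (intro mul_assoc[symmetric]) auto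
    then show "([x, y], [mul x y]) \<in> r" using xy by (auto simp: r_def)
  next
    fix x y assume "x \<in> letters" "y \<in> letters" "adj (vert x) (vert y)"
    then show "([x, y], [y, x]) \<in> r" using adj_irrefl by (auto simp: r_def)
  qed
  then show ?thesis by (simp add: r_def)
qed

section \<open>Products of reduced words\<close>

abbreviation clique :: "'a list \<Rightarrow> bool" where
  "clique K \<equiv> sorted_wrt (\<lambda>x y. adj (vert x) (vert y)) K"

text \<open>With q = x1 ... xn and q' = yn ... y1 this says xi yi = 1 for each i, so
  \<open>q @ q'\<close> collapses from the middle. Only this one-sided product is controlled;
  \<open>q' @ q\<close> need not be trivial.\<close>

definition cancels :: "'a list \<Rightarrow> 'a list \<Rightarrow> bool" where
  "cancels q q' \<longleftrightarrow> list_all2 (\<lambda>x y. vert x = vert y \<and> mul x y = unit (vert y)) q (rev q')"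

lemma cancels_Nil [simp]: "cancels [] []" "cancels q [] \<longleftrightarrow> q = []"
  by (simp_all add: cancels_def)

lemma cancels_Cons_snoc:
  "cancels (x # q) (q' @ [y]) \<longleftrightarrow> vert x = vert y \<and> mul x y = unit (vert y) \<and> cancels q q'"
  by (auto simp: cancels_def)

lemma cancels_verts: assumes "cancels q q'" shows "vert ` set q = vert ` set q'"
proof -
  have "list_all2 (\<lambda>x y. vert x = vert y) q (rev q')"
    using assms unfolding cancels_def by (rule list_all2_mono) simp
  then have "map vert q = map vert (rev q')"
    by (simp add: list_all2_conv_all_nth list_eq_iff_nth_eq)
  then show ?thesis by (metis set_map set_rev)
qed

lemma cancels_left_inverse:
  assumes "cancels q (x # q')"
  obtains y where "y \<in> set q" "vert y = vert x" "mul y x = unit (vert x)"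
proof -
  from assms obtain us y where "q = us @ [y]" "vert y = vert x" "mul y x = unit (vert x)"
    by (auto simp: cancels_def list_all2_append2 list_all2_Cons2)
  then show thesis using that[of y] by simp
qed

lemma cancels_cong:
  "cancels q q' \<Longrightarrow> set q \<subseteq> letters \<Longrightarrow> set q' \<subseteq> letters \<Longrightarrow> q @ q' \<doteq> []"
proof (induction q arbitrary: q')
  case Nil then show ?case by (simp add: cancels_def)
next
  case (Cons x q)
  then obtain p y where q': "q' = p @ [y]" by (cases q' rule: rev_cases) (auto simp: cancels_def)
  have c: "vert x = vert y" "mul x y = unit (vert y)" "cancels q p"
    using Cons.prems q' cancels_Cons_snoc by auto
  have "[x] @ (q @ p) @ [y] \<doteq> [x] @ [] @ [y]"
    using Cons q' c by (intro cong_context) auto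
  also have "\<dots> \<doteq> [mul x y]" using cong_mul[of x y] Cons.prems q' c by simp
  also have "\<dots> \<doteq> []" using c cong_unit[of "vert y"] letterD Cons.prems q' by simp
  finally show ?case using q' by simp
qed

text \<open>Each letter of \<open>H\<close> commutes with all letters of the clique standing before
  its partner \<open>k\<close>, so it travels to \<open>k\<close> and is absorbed there.\<close>

lemma cong_absorb:
  assumes "clique K" "set K \<subseteq> letters" "set H \<subseteq> letters"
    and "\<forall>h\<in>set H. \<exists>k\<in>set K. vert h = vert k \<and> mul h k = k"
  shows "H @ K \<doteq> K"
  using assms(3,4)
proof (induction H)
  case Nil then show ?case using assms(2) by simp
next
  case (Cons h H)
  then obtain k where k: "k \<in> set K" "vert h = vert k" "mul h k = k" by auto
  then obtain A B where K: "K = A @ k # B" by (meson split_list)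
  have A: "commutes h A" using assms(1) K k(2) adj_sym by (auto simp: sorted_wrt_append)
  have "[h] @ (H @ K) \<doteq> [h] @ K" using Cons by (intro cong_append cong_refl) auto
  also have "[h] @ K \<doteq> A @ [h, k] @ B"
    using cong_append[OF cong_sym[OF cong_move[OF A]] cong_refl[of "k # B"]] Cons.prems assms(2) K
    by simp
  also have "\<dots> \<doteq> A @ [k] @ B"
    using cong_mul[of h k] k K Cons.prems assms(2) by (intro cong_context) auto
  finally show ?case using K by simp
qed

section \<open>Letterwise products of cliques\<close>

lemma commutes_map_vert:
  assumes "map vert H = map vert K" shows "commutes x H \<longleftrightarrow> commutes x K"
proof -
  have "vert ` set H = vert ` set K" using arg_cong[OF assms, of set] by simp
  then have "(\<forall>\<beta>\<in>vert ` set H. adj (vert x) \<beta>) \<longleftrightarrow> (\<forall>\<beta>\<in>vert ` set K. adj (vert x) \<beta>)"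
    by (rule arg_cong)
  then show ?thesis by simp
qed

lemma cong_map2_mul:
  assumes "list_all2 (\<lambda>h k. vert h = vert k) H K" "clique K" "set H \<subseteq> letters" "set K \<subseteq> letters"
  shows "H @ K \<doteq> map2 mul H K"
  using assms
proof (induction rule: list_all2_induct)
  case Nil then show ?case by simp
next
  case (Cons h H k K)
  have "map vert H = map vert K"
    using Cons.hyps by (simp add: list_all2_conv_all_nth list_eq_iff_nth_eq)
  then have c: "commutes k H" using Cons.prems(1) commutes_map_vert[of H K k] by simp
  have "[h] @ (H @ [k]) @ K \<doteq> [h] @ (k # H) @ K"
    using Cons.prems c by (intro cong_context cong_move) auto
  also have "[h] @ (k # H) @ K = [h, k] @ (H @ K)" by simp
  also have "[h, k] @ (H @ K) \<doteq> [mul h k] @ map2 mul H K"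
    using Cons by (intro cong_append cong_mul) auto
  finally show ?case by simp
qed

lemma map_vert_map2_mul:
  assumes "list_all2 (\<lambda>h k. vert h = vert k) H K" "set H \<subseteq> letters" "set K \<subseteq> letters"
  shows "map vert (map2 mul H K) = map vert K" "map vert H = map vert K" "set (map2 mul H K) \<subseteq> letters"
  using assms by (induction rule: list_all2_induct) auto

lemma clique_map_vert: "map vert H = map vert K \<Longrightarrow> clique H \<longleftrightarrow> clique K"
proof -
  assume "map vert H = map vert K"
  then have "sorted_wrt adj (map vert H) \<longleftrightarrow> sorted_wrt adj (map vert K)" by simp
  then show ?thesis by (simp add: sorted_wrt_map)
qed

text \<open>The part \<open>q @ q'\<close> of the product \<open>f @ a\<close> cancels completely, and \<open>H @ K\<close> amalgamates letterwise.\<close>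

definition overlap :: "'a list \<Rightarrow> 'a list \<Rightarrow> 'a list \<Rightarrow> 'a list \<Rightarrow> 'a list \<Rightarrow> 'a list \<Rightarrow> 'a list \<Rightarrow> 'a list \<Rightarrow> bool" where
  "overlap f a p H q q' K r \<longleftrightarrow> f \<approx> p @ H @ q \<and> a \<approx> q' @ K @ r \<and> cancels q q' \<and> clique K \<and>
     list_all2 (\<lambda>h k. vert h = vert k) H K \<and> (\<forall>x\<in>set (map2 mul H K). x \<noteq> unit (vert x))"

text \<open>Both \<open>p @ map2 mul H K\<close> and \<open>map2 mul H K @ r\<close> are reduced,
  having the vertex sequences of factors of \<open>f\<close> and \<open>a\<close>. So the
  obstruction pairs a last letter \<open>x\<close> of \<open>p\<close> with a front letter
  \<open>y\<close> of \<open>r\<close> across the clique. The pair moves into \<open>q\<close>,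
  \<open>q'\<close> if x y = 1 and into \<open>H\<close>, \<open>K\<close> otherwise; either way
  \<open>p\<close> gets shorter.\<close>

lemma overlap_step:
  assumes "f \<in> normal" "a \<in> normal" and o: "overlap f a p H q q' K r"
    and n: "\<not> reduced (p @ map2 mul H K @ r)"
  shows "\<exists>p' H' q1 q1' K' r'. overlap f a p' H' q1 q1' K' r' \<and> length p' < length p"
proof -
  let ?N = "map2 mul H K"
  note o' = o[unfolded overlap_def]
  have f: "f \<approx> (p @ H) @ q" and a: "a \<approx> q' @ (K @ r)" using o' by auto
  have rf: "reduced (p @ H)" "set (p @ H) \<subseteq> letters"
    using assms(1) reduced_trace[OF _ f] reduced_appendD(1)[of "p @ H" q] trace_set[OF f]
    by (auto simp: normal_def)
  have ra: "reduced (K @ r)" "set (K @ r) \<subseteq> letters"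
    using assms(2) reduced_trace[OF _ a] reduced_appendD(2)[of q' "K @ r"] trace_set[OF a]
    by (auto simp: normal_def)
  have v: "map vert ?N = map vert K" "map vert H = map vert K"
    using map_vert_map2_mul[of H K] rf ra o' by auto
  have nu: "\<forall>x\<in>set ?N. x \<noteq> unit (vert x)" using o' by blast
  have nonunit: "x \<in> set w \<Longrightarrow> x \<noteq> unit (vert x)" if "reduced w" for x w
    using that by (simp add: reduced_def)
  have pN: "reduced (p @ ?N)"
    by (rule reduced_same_verts[OF rf(1)])
      (use v nu nonunit[OF rf(1)] in auto)
  have Nr: "reduced (?N @ r)"
    by (rule reduced_same_verts[OF ra(1)])
      (use v nu nonunit[OF ra(1)] in auto)
  obtain x y u w where x: "p \<approx> u @ [x]" and y: "?N @ r \<approx> y # w" and xy: "vert x = vert y"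
    by (rule not_reduced_appendE[OF reduced_appendD(1)[OF rf(1)] Nr n])
  \<comment> \<open>If \<open>y\<close> came from the amalgamated clique, \<open>x\<close> and
    \<open>y\<close> would already contradict the reducedness of \<open>p @ ?N\<close>.\<close>
  have yN: "commutes y ?N \<and> (\<exists>r'. r \<approx> y # r')"
    using y
  proof (cases rule: trace_append_ConsE)
    case (left p1 p2)
    have "?N \<approx> y # p1 @ p2" using left trace_move by simp
    then have "p @ ?N \<approx> u @ x # y # (p1 @ p2)" using trace_append[OF x] by force
    then show ?thesis using reducedD[OF pN] xy by blast
  next
    case (right s1 s2)
    then show ?thesis using trace_move by blast
  qed
  then obtain r' where r': "r \<approx> y # r'" by blast
  have cK: "commutes y K" and cH: "commutes x H"
    using yN commutes_map_vert[of ?N K y] commutes_map_vert[of H K x] v xy by auto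
  have lp: "length u < length p" using trace_length[OF x] by simp
  have f': "f \<approx> u @ x # H @ q"
    using trace_trans[OF _ trace_append[OF x trace_refl[of "H @ q"]]] o' by simp
  have a': "a \<approx> q' @ K @ y # r'"
    using trace_trans[OF _ trace_append[OF trace_refl[of "q' @ K"] r']] o' by simp
  show ?thesis
  proof (cases "mul x y = unit (vert y)")
    case True
    have "u @ x # H @ q \<approx> u @ H @ x # q"
      using trace_append[OF trace_refl[of u] trace_sym[OF trace_move[OF cH, of q]]] .
    moreover have "cancels (x # q) (q' @ [y])" using True xy o' cancels_Cons_snoc by blast
    moreover have "q' @ K @ y # r' \<approx> (q' @ [y]) @ K @ r'"
      using trace_append[OF trace_refl[of q'] trace_move[OF cK, of r']] by simp
    ultimately have "overlap f a u H (x # q) (q' @ [y]) K r'"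
      using o' f' a' trace_trans unfolding overlap_def by blast
    then show ?thesis using lp by blast
  next
    case False
    have "q' @ K @ y # r' \<approx> q' @ (y # K) @ r'"
      using trace_append[OF trace_refl[of q'] trace_move[OF cK, of r']] by simp
    moreover have "x \<in> letters" "y \<in> letters"
      using trace_set[OF x] trace_set[OF r'] rf ra by auto
    ultimately have "overlap f a u (x # H) q q' (y # K) r'"
      using o' f' trace_trans[OF a'] cK xy False unfolding overlap_def by auto
    then show ?thesis using lp by blast
  qed
qed

lemma ex_overlap:
  assumes "f \<in> normal" "a \<in> normal"
  obtains p H q q' K r where "overlap f a p H q q' K r" "reduced (p @ map2 mul H K @ r)"
proof -
  let ?P = "\<lambda>n. \<exists>p H q q' K r. overlap f a p H q q' K r \<and> length p = n"
  \<comment> \<open>Without any cancellation yet, all of \<open>f\<close> is \<open>p\<close> and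
    all of \<open>a\<close> is \<open>r\<close>; an overlap with shortest \<open>p\<close> then
    admits no further step.\<close>
  have "overlap f a f [] [] [] [] a" by (simp add: overlap_def)
  then have "?P (length f)" by blast
  then have least: "?P (LEAST n. ?P n)" by (rule LeastI)
  then obtain p H q q' K r where o: "overlap f a p H q q' K r" and p: "length p = (LEAST n. ?P n)"
    by blast
  have "reduced (p @ map2 mul H K @ r)"
  proof (rule ccontr)
    assume "\<not> reduced (p @ map2 mul H K @ r)"
    then obtain p' H' q1 q1' K' r' where s: "overlap f a p' H' q1 q1' K' r'" "length p' < length p"
      using overlap_step[OF assms o] by blast
    have "length p \<le> length p'" unfolding p by (rule Least_le) (use s in blast)
    with s(2) show False by simp
  qed
  with o show thesis by (rule that)
qed

text \<open>The reduced form of the product is p (HK) r, with HK the letterwise product, and it must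
  be a shuffle of a = q' K r. Cancelling r and comparing the suffixes HK and K, which have the same
  vertices, gives HK = K letterwise and p = q'.\<close>

lemma fixing_word:
  assumes "f \<in> normal" "a \<in> normal" "f @ a \<doteq> a"
  obtains q' H q K r where "f \<approx> q' @ H @ q" "a \<approx> q' @ K @ r" "cancels q q'" "clique K"
    "list_all2 (\<lambda>h k. vert h = vert k \<and> mul h k = k) H K"
proof -
  obtain p H q q' K r where o: "overlap f a p H q q' K r" and red: "reduced (p @ map2 mul H K @ r)"
    using ex_overlap[OF assms(1,2)] .
  note o' = o[unfolded overlap_def]
  have f: "f \<approx> p @ H @ q" and a: "a \<approx> q' @ K @ r" using o' by auto
  have lf: "set (p @ H @ q) \<subseteq> letters" "set f \<subseteq> letters" and la: "set (q' @ K @ r) \<subseteq> letters" "set a \<subseteq> letters"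
    using trace_set[OF f] trace_set[OF a] assms by (auto simp: normal_def)
  have v: "map vert (map2 mul H K) = map vert K" "set (map2 mul H K) \<subseteq> letters"
    using map_vert_map2_mul[of H K] o' lf la by auto
  have "f @ a \<doteq> (p @ H) @ (q @ q') @ (K @ r)"
    using cong_append[OF cong_trace[OF f] cong_trace[OF a]] lf la by simp
  also have "\<dots> \<doteq> (p @ H) @ [] @ (K @ r)"
    using cancels_cong o' lf la by (intro cong_context) auto
  also have "\<dots> = p @ (H @ K) @ r" by simp
  also have "\<dots> \<doteq> p @ map2 mul H K @ r"
    using cong_map2_mul o' lf la by (intro cong_context) auto
  finally have "p @ map2 mul H K @ r \<doteq> a" using assms(3) cong_sym cong_trans by blast
  then have "p @ map2 mul H K @ r \<approx> a"
    using red lf la v assms(2) by (intro reduced_unique) (auto simp: normal_def)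
  from trace_trans[OF this a] have "(p @ map2 mul H K) @ r \<approx> (q' @ K) @ r" by simp
  from trace_suffix_same_verts[OF v(1) trace_cancel_right[OF this]]
  have eq: "map2 mul H K = K" and pq: "p \<approx> q'" by auto
  have "f \<approx> q' @ H @ q" using f trace_append[OF pq trace_refl] trace_trans by blast
  moreover have "list_all2 (\<lambda>h k. vert h = vert k \<and> mul h k = k) H K"
  proof -
    have len: "length H = length K" using o' by (auto dest: list_all2_lengthD)
    have "mul (H ! i) (K ! i) = K ! i" if "i < length K" for i
      using arg_cong[OF eq, of "\<lambda>l. l ! i"] that len by simp
    then show ?thesis using o' by (auto simp: list_all2_conv_all_nth)
  qed
  ultimately show thesis
    using a o' by (intro that[of q' H q K r]) simp_all
qed

section \<open>Idempotents fixing a reduced word\<close>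

text \<open>Since q q' = 1, H H = q f f q' = q f q' = H. A clique has at most one letter per vertex,
  so the retraction onto the vertex of \<open>h\<close> sends \<open>H\<close> to
  \<open>h\<close>.\<close>

lemma idempotent_letters:
  assumes f: "f \<approx> q' @ H @ q" and qq: "cancels q q'" and H: "clique H"
    and "f @ f \<doteq> f" "h \<in> set H"
  shows "mul h h = h"
proof -
  have lf: "set f \<subseteq> letters" "set (q' @ H @ q) \<subseteq> letters"
    using cong_letters[OF assms(4)] trace_set[OF f] by simp_all
  have c: "q @ q' \<doteq> []" using cancels_cong[OF qq] lf by simp
  have ff: "f \<doteq> q' @ H @ q" using cong_trace[OF f] lf by simp
  have strip: "(q @ q') @ L @ (q @ q') \<doteq> L" if "set L \<subseteq> letters" for L
    using cong_append[OF c cong_append[OF cong_refl[OF that] c]] by simp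
  have "H @ H \<doteq> (q @ q') @ (H @ H) @ (q @ q')" using strip[of "H @ H"] lf cong_sym by simp
  also have "\<dots> \<doteq> (q @ q' @ H) @ (q @ q') @ (H @ q @ q')"
    using cong_context[OF cong_sym[OF c], of "q @ q' @ H" "H @ q @ q'"] lf by simp
  also have "\<dots> = q @ ((q' @ H @ q) @ (q' @ H @ q)) @ q'" by simp
  also have "\<dots> \<doteq> q @ (q' @ H @ q) @ q'"
    using cong_append[OF cong_sym[OF ff] cong_sym[OF ff]] assms(4) ff cong_trans lf
    by (intro cong_context) (blast, simp_all)
  also have "\<dots> \<doteq> H" using strip[of H] lf by simp
  finally have HH: "H @ H \<doteq> H" .
  have h: "h \<in> letters" "vert h \<in> V" using assms(5) lf letterD by auto
  obtain A B where AB: "H = A @ h # B" using assms(5) by (meson split_list)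
  have triv: "retract (vert h) L = unit (vert h)" if "\<forall>x\<in>set L. vert x \<noteq> vert h" for L
    using that by (induction L) auto
  have "retract (vert h) A = unit (vert h)" "retract (vert h) B = unit (vert h)"
    using H adj_irrefl unfolding AB by (intro triv; fastforce simp: sorted_wrt_append)+
  moreover have "set A \<subseteq> letters" "set B \<subseteq> letters" using AB lf by auto
  ultimately have "retract (vert h) H = h"
    using retract_append[OF h(2), of A "h # B"] h by (simp add: AB)
  moreover have "retract (vert h) (H @ H) = mul (retract (vert h) H) (retract (vert h) H)"
    using retract_append[OF h(2)] lf by simp
  ultimately show ?thesis using retract_cong[OF HH h(2)] by simp
qed

text \<open>The word \<open>g\<close> depends on where the front letter \<open>x\<close> of a = q' K
  r sits: in q', in K, or in r beyond both. In the last two cases \<open>x\<close> commutes with q',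
  hence also with q, which has the same vertices.\<close>

lemma fixing_idempotent_shift:
  assumes f: "f \<in> normal" "f @ f \<doteq> f" and a: "a \<in> normal" "f @ a \<doteq> a" "a \<approx> x # b"
  obtains g where "g @ g \<doteq> g" "f @ [x] \<doteq> x # g"
proof -
  obtain q' H q K r where fq: "f \<approx> q' @ H @ q" and aq: "a \<approx> q' @ K @ r" and qq: "cancels q q'"
    and K: "clique K" and HK: "list_all2 (\<lambda>h k. vert h = vert k \<and> mul h k = k) H K"
    using fixing_word[OF f(1) a(1,2)] .
  have vHK: "map vert H = map vert K"
    using HK by (simp add: list_all2_conv_all_nth list_eq_iff_nth_eq)
  have H: "clique H" using clique_map_vert[OF vHK] K by simp
  have idem: "mul h h = h" if "h \<in> set H" for h
    using idempotent_letters[OF fq qq H f(2) that] .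
  have l: "set (q' @ H @ q) \<subseteq> letters" "set f \<subseteq> letters" "x \<in> letters" "set (K @ r) \<subseteq> letters"
    using trace_set[OF fq] trace_set[OF aq] trace_set[OF a(3)] f(1) a(1) by (auto simp: normal_def)
  have c: "q @ q' \<doteq> []" using cancels_cong[OF qq] l by simp
  have ff: "f @ [x] \<doteq> (q' @ H @ q) @ [x]"
    using cong_append[OF cong_trace[OF fq]] l by simp
  have idem_cong: "L @ L \<doteq> L" if "clique L" "set L \<subseteq> set H" for L
    using that idem l by (intro cong_absorb) auto
  have "q' @ (K @ r) \<approx> x # b" using trace_trans[OF trace_sym[OF aq] a(3)] by simp
  then show thesis
  proof (cases rule: trace_append_ConsE)
    case (left p1 p2)
    \<comment> \<open>Here q' is \<open>x\<close> followed by \<open>p1 @ p2\<close>, so f x starts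
      with \<open>x\<close>, and \<open>?g\<close> is what remains. In its square the middle factor
      is q q' and vanishes.\<close>
    let ?g = "(p1 @ p2) @ H @ q @ [x]"
    have q': "q' \<approx> x # p1 @ p2" using left trace_move by simp
    have l': "set (p1 @ p2) \<subseteq> letters" using left l by auto
    have "f @ [x] \<doteq> q' @ (H @ q @ [x])" using ff by simp
    also have "\<dots> \<doteq> (x # p1 @ p2) @ H @ q @ [x]"
      using cong_trace[OF q'] l by (intro cong_append cong_refl) auto
    finally have fx: "f @ [x] \<doteq> x # ?g" by simp
    have "q @ x # p1 @ p2 \<doteq> q @ q'"
      using cong_append[OF cong_refl cong_sym[OF cong_trace[OF q']]] l by simp
    then have c': "q @ x # p1 @ p2 \<doteq> []" using c by (rule cong_trans)
    have "?g @ ?g = ((p1 @ p2) @ H) @ (q @ x # p1 @ p2) @ (H @ q @ [x])" by simp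
    also have "\<dots> \<doteq> ((p1 @ p2) @ H) @ [] @ (H @ q @ [x])"
      using c' l l' by (intro cong_context) auto
    also have "\<dots> = (p1 @ p2) @ (H @ H) @ (q @ [x])" by simp
    also have "\<dots> \<doteq> (p1 @ p2) @ H @ (q @ [x])"
      using idem_cong[of H] H l l' by (intro cong_context) auto
    finally have "?g @ ?g \<doteq> ?g" by simp
    then show ?thesis using fx by (rule that)
  next
    case (right s1 s2)
    have cq: "commutes x q"
      using right(2) cancels_verts[OF qq] by (metis (no_types, lifting) image_iff)
    show ?thesis
    proof (cases "\<exists>A B. K = A @ x # B")
      case True
      then obtain A B where KAB: "K = A @ x # B" by blast
      then have cAB: "commutes x A" "commutes x B"
        using K adj_sym by (auto simp: sorted_wrt_append)
      obtain A' h B' where H': "H = A' @ h # B'" "length A' = length A"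
        and h: "vert h = vert x" "mul h x = x"
        using HK unfolding KAB by (auto simp: list_all2_append2 list_all2_Cons2)
      have vAB: "map vert A' = map vert A" "map vert B' = map vert B"
        using vHK H' unfolding KAB by simp_all
      have cAB': "commutes x A'" "commutes x B'"
        using cAB commutes_map_vert[OF vAB(1)] commutes_map_vert[OF vAB(2)] by simp_all
      \<comment> \<open>The partner \<open>h\<close> of \<open>x\<close> is absorbed by h x = x, and
        \<open>x\<close> passes everything else, so \<open>g\<close> is \<open>f\<close> with
        \<open>h\<close> removed.\<close>
      let ?L = "A' @ B'"
      have L: "?L @ ?L \<doteq> ?L"
        using H H' by (intro idem_cong) (auto simp: sorted_wrt_append)
      have "f @ [x] \<doteq> (q' @ A' @ [h]) @ (B' @ q) @ [x]" using ff H' by simp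
      also have "\<dots> \<doteq> (q' @ A' @ [h]) @ x # (B' @ q)"
        using l H' cAB' cq by (intro cong_append cong_move cong_refl) auto
      also have "\<dots> = (q' @ A') @ [h, x] @ (B' @ q)" by simp
      also have "\<dots> \<doteq> (q' @ A') @ [x] @ (B' @ q)"
        using cong_mul[of h x] h l H' by (intro cong_context) auto
      also have "\<dots> = ((q' @ A') @ [x]) @ (B' @ q)" by simp
      also have "\<dots> \<doteq> (x # (q' @ A')) @ (B' @ q)"
        using l H' cAB' right(2) by (intro cong_append cong_move cong_refl) auto
      finally have fx: "f @ [x] \<doteq> x # (q' @ ?L @ q)" by simp
      have "(q' @ ?L @ q) @ (q' @ ?L @ q) = (q' @ ?L) @ (q @ q') @ (?L @ q)" by simp
      also have "\<dots> \<doteq> (q' @ ?L) @ [] @ (?L @ q)"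
        using c l H' by (intro cong_context) auto
      also have "\<dots> = q' @ (?L @ ?L) @ q" by simp
      also have "\<dots> \<doteq> q' @ ?L @ q" using L l H' by (intro cong_context) auto
      finally show ?thesis using fx by (rule that)
    next
      case False
      \<comment> \<open>Now \<open>x\<close> stems from r and has passed all of \<open>K\<close>; it
        commutes with the whole of \<open>f\<close>, and \<open>g\<close> can be \<open>f\<close>
        itself.\<close>
      have "commutes x K"
      proof -
        obtain us where "K = s1 @ us \<and> us @ r = x # s2 \<or> s1 = K @ us"
          using right(1) by (auto simp: append_eq_append_conv2)
        then show ?thesis using False right(3) by (cases us) auto
      qed
      then have "commutes x H" using commutes_map_vert[OF vHK] by simp
      then have "commutes x f" using right(2) cq trace_set[OF fq] by auto
      then have "f @ [x] \<doteq> x # f" using cong_move[of f x] l by simp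
      with f(2) show ?thesis by (rule that)
    qed
  qed
qed

text \<open>Take a longest clique that can be shuffled to the front. A front letter outside it would
  commute with all of it and extend it.\<close>

lemma ex_head_clique: "\<exists>K s. a \<approx> K @ s \<and> clique K \<and> (\<forall>x z. a \<approx> x # z \<longrightarrow> x \<in> set K)"
proof -
  let ?P = "\<lambda>K. (\<exists>s. a \<approx> K @ s) \<and> clique K"
  have "?P []" by (auto intro: exI[of _ a])
  moreover have "\<forall>K. ?P K \<longrightarrow> length K < Suc (length a)" using trace_length by fastforce
  ultimately obtain K where K: "?P K" and max: "\<And>K'. ?P K' \<Longrightarrow> length K' \<le> length K"
    using ex_has_greatest_nat[of ?P "[]" length "Suc (length a)"] by blast
  from K obtain s where s: "a \<approx> K @ s" by blast
  have "x \<in> set K" if t: "a \<approx> x # z" for x z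
  proof -
    have "K @ s \<approx> x # z" using trace_trans[OF trace_sym[OF s] t] .
    then show ?thesis
    proof (cases rule: trace_append_ConsE)
      case (left p1 p2) then show ?thesis by simp
    next
      case (right s1 s2)
      have "a \<approx> (x # K) @ s1 @ s2"
        using trace_trans[OF t trace_Cons[OF right(4)]] by simp
      moreover have "clique (x # K)" using right(2) K by simp
      ultimately have "length (x # K) \<le> length K" by (intro max) blast
      then show ?thesis by simp
    qed
  qed
  then show ?thesis using s K by blast
qed

end

section \<open>Left Fountain vertex monoids\<close>

locale fountain_graph_product = graph_product_words V E M
  for V :: "'v set" and E and M :: "'v \<Rightarrow> ('a, 'm) monoid_scheme" +
  assumes fountain: "\<And>\<alpha>. \<alpha> \<in> V \<Longrightarrow> left_fountain (M \<alpha>)"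
begin

text \<open>The idempotent related to \<open>x\<close> fixes itself, hence fixes
  \<open>x\<close>.\<close>

lemma ex_letter_plus:
  assumes x: "x \<in> letters"
  shows "\<exists>e\<in>letters. vert e = vert x \<and> mul e e = e \<and> mul e x = x \<and>
    (\<forall>f\<in>letters. vert f = vert x \<longrightarrow> mul f f = f \<longrightarrow> mul f x = x \<longrightarrow> mul f e = e)"
proof -
  note vx = letterD[OF x]
  obtain e where e: "e \<in> idempotents (M (vert x))" and xe: "(x, e) \<in> R_tilde (M (vert x))"
    using fountain[OF vx(1)] vx(2) unfolding left_fountain_def by blast
  have le: "e \<in> letters" "vert e = vert x"
    using e vx(1) letterI vert_eq by (auto simp: idempotents_def)
  have f: "mul f x = x \<longleftrightarrow> mul f e = e" if "f \<in> letters" "vert f = vert x" "mul f f = f" for f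
    using xe that letterD(2)[OF that(1)] unfolding R_tilde_def idempotents_def mul_def by auto
  have "mul e e = e" using e le by (simp add: idempotents_def mul_def)
  then show ?thesis using le f by blast
qed

definition letter_plus :: "'a \<Rightarrow> 'a" where
  "letter_plus x = (SOME e. e \<in> letters \<and> vert e = vert x \<and> mul e e = e \<and> mul e x = x \<and>
    (\<forall>f\<in>letters. vert f = vert x \<longrightarrow> mul f f = f \<longrightarrow> mul f x = x \<longrightarrow> mul f e = e))"

lemma letter_plus:
  assumes "x \<in> letters"
  shows "letter_plus x \<in> letters" "vert (letter_plus x) = vert x" "mul (letter_plus x) (letter_plus x) = letter_plus x" "mul (letter_plus x) x = x"
    "\<And>f. f \<in> letters \<Longrightarrow> vert f = vert x \<Longrightarrow> mul f f = f \<Longrightarrow> mul f x = x \<Longrightarrow> mul f (letter_plus x) = letter_plus x"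
proof -
  have "letter_plus x \<in> letters \<and> vert (letter_plus x) = vert x \<and> mul (letter_plus x) (letter_plus x) = letter_plus x \<and> mul (letter_plus x) x = x \<and>
    (\<forall>f\<in>letters. vert f = vert x \<longrightarrow> mul f f = f \<longrightarrow> mul f x = x \<longrightarrow> mul f (letter_plus x) = letter_plus x)"
    unfolding letter_plus_def by (rule someI_ex) (use ex_letter_plus[OF assms] in blast)
  then show "letter_plus x \<in> letters" "vert (letter_plus x) = vert x" "mul (letter_plus x) (letter_plus x) = letter_plus x" "mul (letter_plus x) x = x"
    "\<And>f. f \<in> letters \<Longrightarrow> vert f = vert x \<Longrightarrow> mul f f = f \<Longrightarrow> mul f x = x \<Longrightarrow> mul f (letter_plus x) = letter_plus x"
    by blast+
qed

text \<open>With q' and q empty, \<open>f\<close> is a shuffle of \<open>H\<close>. Its letters are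
  idempotents fixing front letters of \<open>a\<close>, which all lie in \<open>K\<close>; so they
  fix the corresponding \<open>letter_plus\<close> and are absorbed.\<close>

lemma fixing_word_clique:
  assumes f: "f \<in> normal" "f @ f \<doteq> f" and a: "a \<in> normal" "f @ a \<doteq> a"
    and no: "\<And>x y z. a \<approx> x # z \<Longrightarrow> y \<in> letters \<Longrightarrow> vert y = vert x \<Longrightarrow> mul y x \<noteq> unit (vert x)"
    and K: "clique K" "\<And>x z. a \<approx> x # z \<Longrightarrow> x \<in> set K" "set K \<subseteq> letters"
  shows "f @ map letter_plus K \<doteq> map letter_plus K"
proof -
  obtain q' H q K' r where fq: "f \<approx> q' @ H @ q" and aq: "a \<approx> q' @ K' @ r" and qq: "cancels q q'"
    and K': "clique K'" and HK: "list_all2 (\<lambda>h k. vert h = vert k \<and> mul h k = k) H K'"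
    using fixing_word[OF f(1) a(1,2)] .
  have l: "set (q' @ H @ q) \<subseteq> letters" "set f \<subseteq> letters"
    using trace_set[OF fq] f(1) by (auto simp: normal_def)
  have "q' = []"
  proof (cases q')
    case (Cons x p)
    then obtain y where "y \<in> set q" "vert y = vert x" "mul y x = unit (vert x)"
      using cancels_left_inverse qq by blast
    then show ?thesis using no[of x "p @ K' @ r" y] aq Cons l by auto
  qed simp
  then have fH: "f \<approx> H" and aK: "a \<approx> K' @ r" using fq aq qq cancels_verts[OF qq] by auto
  have vHK: "map vert H = map vert K'"
    using HK by (simp add: list_all2_conv_all_nth list_eq_iff_nth_eq)
  have H: "clique H" using clique_map_vert[OF vHK] K' by simp
  have "\<exists>k\<in>set (map letter_plus K). vert h = vert k \<and> mul h k = k" if h: "h \<in> set H" for h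
  proof -
    obtain H1 H2 where "H = H1 @ h # H2" using h by (meson split_list)
    with HK obtain K1 k K2 where "K' = K1 @ k # K2" and hk: "vert h = vert k" "mul h k = k"
      by (auto simp: list_all2_append1 list_all2_Cons1)
    then have k: "k \<in> set K'" "vert h = vert k" "mul h k = k" by simp_all
    obtain A B where AB: "K' = A @ k # B" using k(1) by (meson split_list)
    have "commutes k A" using K' AB adj_sym by (auto simp: sorted_wrt_append)
    then have "A @ k # B @ r \<approx> k # A @ B @ r" by (rule trace_move)
    then have "k \<in> set K" using K(2)[of k "A @ B @ r"] trace_trans[OF aK] AB by simp
    moreover have "mul h h = h" using idempotent_letters[OF fq qq H f(2) h] .
    moreover have "h \<in> letters" using h l by auto
    ultimately show ?thesis using k K(3) letter_plus(2,5)[of k] by (auto intro!: bexI[of _ k])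
  qed
  moreover have "clique (map letter_plus K)"
    using clique_map_vert[of "map letter_plus K" K] K letter_plus by (auto simp: subset_iff)
  moreover have "set (map letter_plus K) \<subseteq> letters" using K letter_plus by auto
  ultimately have "H @ map letter_plus K \<doteq> map letter_plus K" using l by (intro cong_absorb) auto
  moreover have "f @ map letter_plus K \<doteq> H @ map letter_plus K"
    using cong_trace[OF fH] l K letter_plus by (intro cong_append cong_refl) auto
  ultimately show ?thesis using cong_trans by blast
qed

lemma ex_word_plus:
  assumes "a \<in> normal"
  shows "\<exists>e. e @ e \<doteq> e \<and> e @ a \<doteq> a \<and> (\<forall>f. f @ f \<doteq> f \<longrightarrow> f @ a \<doteq> a \<longrightarrow> f @ e \<doteq> e)"
  using assms
proof (induction "length a" arbitrary: a)
  case 0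
  then show ?case using cong_refl[of "[]"] by (intro exI[of _ "[]"]) simp
next
  case (Suc n)
  have la: "set a \<subseteq> letters" using Suc.prems by (simp add: normal_def)
  \<comment> \<open>The structure results concern reduced words, so an arbitrary idempotent
    \<open>f\<close> is first replaced by a reduced representative.\<close>
  have reduce: "\<exists>g\<in>normal. f \<doteq> g \<and> g @ g \<doteq> g \<and> g @ a \<doteq> a" if f: "f @ f \<doteq> f" "f @ a \<doteq> a" for f
  proof -
    obtain g where g: "g \<in> normal" "f \<doteq> g"
      using ex_normal[of f] cong_letters[OF f(1)] by auto
    have "g @ g \<doteq> g" using cong_append[OF g(2) g(2)] f(1) g(2) cong_trans cong_sym by blast
    moreover have "g @ a \<doteq> a"
      using cong_append[OF g(2) cong_refl[OF la]] f(2) cong_trans cong_sym by blast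
    ultimately show ?thesis using g by blast
  qed
  show ?case
  proof (cases "\<exists>x y z. a \<approx> x # z \<and> y \<in> letters \<and> vert y = vert x \<and> mul y x = unit (vert x)")
    case True
    then obtain x y b where t: "a \<approx> x # b" and y: "y \<in> letters" "vert y = vert x" "mul y x = unit (vert x)"
      by blast
    have xb: "x # b \<in> normal" using normal_trace[OF Suc.prems t] .
    then have b: "b \<in> normal" "x \<in> letters" "set b \<subseteq> letters"
      using reduced_ConsD(2) by (auto simp: normal_def)
    have "n = length b" using Suc.hyps(2) trace_length[OF t] by simp
    from Suc.hyps(1)[OF this b(1)] obtain e where e: "e @ e \<doteq> e" "e @ b \<doteq> b"
      and emin: "\<And>f. f @ f \<doteq> f \<Longrightarrow> f @ b \<doteq> b \<Longrightarrow> f @ e \<doteq> e" by blast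
    have le: "set e \<subseteq> letters" using cong_letters[OF e(1)] by simp
    have yx: "[y, x] \<doteq> []"
      using cong_mul[of y x] cong_unit[of "vert x"] y b(2) letterD cong_trans by simp
    have yx': "p @ [y, x] @ s \<doteq> p @ s" if "set p \<subseteq> letters" "set s \<subseteq> letters" for p s
      using cong_context[OF yx that] by simp
    let ?e = "x # e @ [y]"
    have "?e @ ?e = (x # e) @ [y, x] @ (e @ [y])" by simp
    also have "\<dots> \<doteq> (x # e) @ (e @ [y])" using le b y by (intro yx') auto
    also have "\<dots> = [x] @ (e @ e) @ [y]" by simp
    also have "\<dots> \<doteq> [x] @ e @ [y]" using e(1) b y by (intro cong_context) auto
    finally have ee: "?e @ ?e \<doteq> ?e" by simp
    have ta: "a \<doteq> x # b" using cong_trace[OF t la] .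
    have "?e @ a \<doteq> ?e @ x # b" using ta le b y by (intro cong_append cong_refl) auto
    also have "\<dots> = (x # e) @ [y, x] @ b" by simp
    also have "\<dots> \<doteq> (x # e) @ b" using le b by (intro yx') auto
    also have "\<dots> = [x] @ (e @ b)" by simp
    also have "\<dots> \<doteq> [x] @ b" using e(2) b by (intro cong_append cong_refl) auto
    also have "\<dots> \<doteq> a" using cong_sym[OF ta] by simp
    finally have ea: "?e @ a \<doteq> a" .
    have "f @ ?e \<doteq> ?e" if f: "f @ f \<doteq> f" "f @ a \<doteq> a" for f
    proof -
      obtain f' where f': "f' \<in> normal" "f \<doteq> f'" "f' @ f' \<doteq> f'" "f' @ a \<doteq> a"
        using reduce[OF f] by blast
      obtain g where g: "g @ g \<doteq> g" "f' @ [x] \<doteq> x # g"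
        using fixing_idempotent_shift[OF f'(1,3) Suc.prems f'(4) t] .
      have fx: "f @ [x] \<doteq> x # g"
        using cong_append[OF f'(2) cong_refl[of "[x]"]] g(2) b(2) cong_trans by simp
      have lg: "set g \<subseteq> letters" using cong_letters[OF g(1)] by simp
      have xg: "x # g @ s \<doteq> f @ x # s" if "set s \<subseteq> letters" for s
        using cong_append[OF cong_sym[OF fx] cong_refl[OF that]] by simp
      \<comment> \<open>The left inverse \<open>y\<close> cancels \<open>x\<close>: g b = y x g b =
        y f x b = y x b = b.\<close>
      have "g @ b \<doteq> [y, x] @ (g @ b)" using cong_sym[OF yx'[of "[]" "g @ b"]] lg b by simp
      also have "\<dots> = [y] @ (x # g @ b)" by simp
      also have "\<dots> \<doteq> [y] @ (f @ x # b)" using xg b y by (intro cong_append cong_refl) auto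
      also have "\<dots> \<doteq> [y] @ (x # b)"
      proof (intro cong_append cong_refl)
        have "f @ x # b \<doteq> f @ a"
          using cong_append[OF cong_refl cong_sym[OF ta]] cong_letters[OF f(1)] by simp
        then show "f @ x # b \<doteq> x # b" using f(2) ta cong_trans by blast
      qed (use y in auto)
      also have "\<dots> \<doteq> b" using yx'[of "[]" b] b by simp
      finally have "g @ e \<doteq> e" using emin[OF g(1)] by blast
      have "f @ ?e \<doteq> x # g @ (e @ [y])"
        using cong_sym[OF xg[of "e @ [y]"]] le y by simp
      also have "\<dots> = [x] @ (g @ e) @ [y]" by simp
      also have "\<dots> \<doteq> [x] @ e @ [y]" using \<open>g @ e \<doteq> e\<close> b y by (intro cong_context) auto
      finally show ?thesis by simp
    qed
    with ee ea show ?thesis by blast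
  next
    case False
    obtain K s where K: "a \<approx> K @ s" "clique K" "\<And>x z. a \<approx> x # z \<Longrightarrow> x \<in> set K"
      using ex_head_clique by blast
    \<comment> \<open>A clique of idempotent letters is idempotent, and it fixes \<open>a\<close>
      because it fixes the front clique \<open>K\<close>.\<close>
    let ?e = "map letter_plus K"
    have lK: "set K \<subseteq> letters" "set s \<subseteq> letters" using trace_set[OF K(1)] la by auto
    have le: "set ?e \<subseteq> letters" using lK letter_plus by auto
    have ce: "clique ?e" using clique_map_vert[of ?e K] K(2) lK letter_plus by (auto simp: subset_iff)
    have "?e @ ?e \<doteq> ?e"
      by (rule cong_absorb[OF ce le le]) (use letter_plus(2,3) lK in fastforce)
    moreover have eK: "?e @ K \<doteq> K"
      by (rule cong_absorb[OF K(2) lK(1) le]) (use letter_plus(2,4) lK in fastforce)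
    have "?e @ a \<doteq> a"
    proof -
      have "?e @ a \<doteq> ?e @ (K @ s)" using cong_trace[OF K(1) la] le by (intro cong_append cong_refl)
      also have "\<dots> = (?e @ K) @ s" by simp
      also have "\<dots> \<doteq> K @ s" using eK lK by (intro cong_append cong_refl)
      also have "\<dots> \<doteq> a" using cong_sym[OF cong_trace[OF K(1) la]] .
      finally show ?thesis .
    qed
    moreover have "f @ ?e \<doteq> ?e" if f: "f @ f \<doteq> f" "f @ a \<doteq> a" for f
    proof -
      obtain g where g: "g \<in> normal" "f \<doteq> g" "g @ g \<doteq> g" "g @ a \<doteq> a"
        using reduce[OF f] by blast
      have "g @ ?e \<doteq> ?e"
        by (rule fixing_word_clique[OF g(1,3) Suc.prems g(4)]) (use False K lK in blast)+
      then show ?thesis using cong_append[OF g(2) cong_refl[OF le]] cong_trans by blast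
    qed
    ultimately show ?thesis by blast
  qed
qed

end

section \<open>From words to classes in the quotient monoid\<close>

theorem theorem6p10:
  fixes V :: "'v set" and E :: "'v set set"
    and M :: "'v \<Rightarrow> ('a, 'm) monoid_scheme"
  assumes "simple_graph V E"
    and "infinite V \<or> card V \<ge> 2"
    and "\<And>\<alpha>. \<alpha> \<in> V \<Longrightarrow> monoid (M \<alpha>)"
    and "disjoint_family_on (\<lambda>\<alpha>. carrier (M \<alpha>)) V"
    and "\<And>\<alpha>. \<alpha> \<in> V \<Longrightarrow> left_fountain (M \<alpha>)"
  shows "monoid (graph_product V E M) \<and> left_fountain (graph_product V E M)"
proof -
  interpret fountain_graph_product V E M
    using assms
    by (simp add: fountain_graph_product_def graph_product_words_def fountain_graph_product_axioms_def)
  let ?F = "free_monoid letters"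
  let ?r = "generated_congruence ?F (graph_product_relations V E M)"
  let ?P = "graph_product V E M"
  have P: "?P = quotient_monoid ?F ?r"
    by (simp add: graph_product_def letters_def Let_def)
  have carrier: "carrier ?P = lists letters // ?r"
    by (simp add: P quotient_monoid_def free_monoid_def)
  have mult: "?r `` {u} \<otimes>\<^bsub>?P\<^esub> ?r `` {w} = ?r `` {u @ w}" if "set u \<subseteq> letters" "set w \<subseteq> letters" for u w
    using quotient_monoid_mult[OF congruence_generated, of u w] that by (auto simp: P free_monoid_def)
  have eq: "?r `` {u} = ?r `` {w} \<longleftrightarrow> word_cong u w" if "set u \<subseteq> letters" "set w \<subseteq> letters" for u w
    using eq_equiv_class_iff[OF cong_equiv, of u w] that by (auto simp: word_cong_def)
  have idem: "?r `` {f} \<in> idempotents ?P \<longleftrightarrow> word_cong (f @ f) f" if "set f \<subseteq> letters" for f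
    using that by (auto simp: idempotents_def mult eq carrier intro!: quotientI)
  have "left_fountain ?P"
    unfolding left_fountain_def
  proof
    fix X assume "X \<in> carrier ?P"
    then obtain w where w: "set w \<subseteq> letters" "X = ?r `` {w}"
      unfolding carrier by (auto elim!: quotientE)
    obtain a where a: "a \<in> normal" "word_cong w a" using ex_normal[OF w(1)] by blast
    have la: "set a \<subseteq> letters" using a(1) by (simp add: normal_def)
    have X: "X = ?r `` {a}" using eq[OF w(1) la] a(2) w(2) by simp
    obtain e where e: "word_cong (e @ e) e" "word_cong (e @ a) a"
      and emin: "\<And>f. word_cong (f @ f) f \<Longrightarrow> word_cong (f @ a) a \<Longrightarrow> word_cong (f @ e) e"
      using ex_word_plus[OF a(1)] by blast
    have le: "set e \<subseteq> letters" using cong_letters[OF e(1)] by simp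
    have iff: "word_cong (f @ a) a \<longleftrightarrow> word_cong (f @ e) e" if f: "word_cong (f @ f) f" for f
    proof
      assume fe: "word_cong (f @ e) e"
      have lf: "set f \<subseteq> letters" using cong_letters[OF f] by simp
      have "word_cong (f @ a) ((f @ e) @ a)"
        using cong_append[OF cong_refl[OF lf] cong_sym[OF e(2)]] by simp
      also have "word_cong ((f @ e) @ a) (e @ a)" using cong_append[OF fe cong_refl[OF la]] .
      also have "word_cong (e @ a) a" by (fact e(2))
      finally show "word_cong (f @ a) a" .
    qed (rule emin[OF f])
    have "F \<otimes>\<^bsub>?P\<^esub> ?r `` {a} = ?r `` {a} \<longleftrightarrow> F \<otimes>\<^bsub>?P\<^esub> ?r `` {e} = ?r `` {e}"
      if F: "F \<in> idempotents ?P" for F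
    proof -
      have "F \<in> lists letters // ?r" using F carrier by (simp add: idempotents_def)
      then obtain f where f: "set f \<subseteq> letters" "F = ?r `` {f}" by (auto elim!: quotientE)
      with F have "word_cong (f @ f) f" using idem by simp
      then show ?thesis using iff[of f] f la le mult eq by simp
    qed
    moreover have "?r `` {a} \<in> carrier ?P" "?r `` {e} \<in> carrier ?P"
      using la le unfolding carrier by (auto intro!: quotientI)
    ultimately have "(X, ?r `` {e}) \<in> R_tilde ?P" unfolding R_tilde_def X by blast
    then show "\<exists>E\<in>idempotents ?P. (X, E) \<in> R_tilde ?P" using idem[OF le] e(1) by blast
  qed
  then show ?thesis
    using monoid_quotient_monoid[OF monoid_free_monoid congruence_generated] by (simp add: P)
qed

end
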